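(* For any $\delta,\lambda>0$ and $t\ge 0$ let $$\gamma_t(\delta,\lambda)=\sqrt\lambda\Big(\frac1{2M}+S\Big)+\frac{2Md}{\sqrt\lambda}\Big(1+\frac12\log\Big(1+\frac{tL}{\lambda d}\Big)\Big)+\frac{2M}{\sqrt\lambda}\log(1/\delta),$$ and let $\mathcal E(\delta,\lambda)$ be the event $$\mathcal E(\delta,\lambda)=\Big\{\forall t\ge0,\ \big\|g_t(\hat\theta_t)-g_t(\theta_\star)\big\|_{H_t^{-1}}\le\gamma_t(\delta,\lambda)\Big\}.$$ Then, under the assumptions in the context, $\mathbb{P}(\mathcal E(\delta,\lambda))\ge1-\delta$.
   Context: Notation: $\|\cdot\|$ is the Euclidean norm on $\mathbb{R}^d$, $\|v\|_A^2=v^\top Av$ for positive definite $A$, dots denote derivatives. Assumptions. $Q$ is a non-degenerate probability distribution on $\mathbb{R}$ with $\psi(u)=\log\int e^{uy}Q(dy)<\infty$ for all $u\in\mathbb{R}$; $Q_u(dy)=\exp(yu-\psi(u))Q(dy)$ and $\mu(u)=\dot\psi(u)$ is the mean of $Q_u$. For constants $L,M,S>0$: $\dot\mu(u)\le L$ and $|\ddot\mu(u)|\le M\dot\mu(u)$ for all $u\in\mathbb{R}$. The arm set $\mathcal X\subset\{x\in\mathbb{R}^d:\|x\|\le1\}$ is closed, and $\theta_\star\in\mathbb{R}^d$ satisfies $\|\theta_\star\|\le S$. Data. $(X_t,Y_t)_{t\ge1}$ is a random sequence with $X_t\in\mathcal X$, $Y_t\in\mathbb{R}$, generated by sequential interaction: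 $X_t$ is chosen based on the past (and independent randomisation), and the conditional distribution of $Y_t$ given the past and $X_t$ is $Q_{X_t^\top\theta_\star}$. Definitions. For $t\ge0$: $\hat\theta_t=\arg\min_{\theta\in\mathbb{R}^d}\ \frac\lambda2\|\theta\|^2-\sum_{i=1}^t\big(Y_iX_i^\top\theta-\psi(X_i^\top\theta)\big)$ (the regularised maximum likelihood estimate); $g_t(\theta)=\sum_{i=1}^t\mu(X_i^\top\theta)X_i+\lambda\theta$; $H_t=\sum_{i=1}^t\dot\mu(X_i^\top\theta_\star)X_iX_i^\top+\lambda I_d$. *)

theory Defs
  imports "HOL-Probability.Probability"
begin

definition psi :: "real measure \<Rightarrow> real \<Rightarrow> real" where
  "psi Q u = ln (\<integral>y. exp (u * y) \<partial>Q)"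

definition tilted :: "real measure \<Rightarrow> real \<Rightarrow> real measure" where
  "tilted Q u = density Q (\<lambda>y. ennreal (exp (y * u - psi Q u)))"

definition mu :: "real measure \<Rightarrow> real \<Rightarrow> real" where
  "mu Q = deriv (psi Q)"

definition non_degenerate :: "real measure \<Rightarrow> bool" where
  "non_degenerate Q \<longleftrightarrow> (\<forall>c. Q \<noteq> return borel c)"

text \<open>The kernel \<open>K\<close> is a version of the conditional distribution of \<open>Y\<close> given
  the sub-sigma-algebra \<open>F\<close> of \<open>P\<close>.\<close>

definition has_cond_distr ::
    "'w measure \<Rightarrow> 'w measure \<Rightarrow> ('w \<Rightarrow> real) \<Rightarrow> ('w \<Rightarrow> real measure) \<Rightarrow> bool" where
  "has_cond_distr P F Y K \<longleftrightarrow>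
     Y \<in> borel_measurable P \<and>
     (\<forall>A\<in>sets borel. AE w in P. real_cond_exp P F (\<lambda>w. indicator A (Y w)) w = measure (K w) A)"

text \<open>Rounds are numbered from 1. The sigma-algebra \<open>F t\<close> is the information available just
  before \<open>Y t\<close> is revealed: the earlier rounds, \<open>X t\<close>, and any additional randomisation
  used in choosing \<open>X 1, \<dots>, X t\<close>. The algebras and variables at index 0 play no role.\<close>

definition sequential_interaction ::
    "'w measure \<Rightarrow> (nat \<Rightarrow> 'w measure) \<Rightarrow> real measure \<Rightarrow> (real ^ 'd) set \<Rightarrow> real ^ 'd \<Rightarrow>
     (nat \<Rightarrow> 'w \<Rightarrow> real ^ 'd) \<Rightarrow> (nat \<Rightarrow> 'w \<Rightarrow> real) \<Rightarrow> bool" where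
  "sequential_interaction P F Q \<X> \<theta>s X Y \<longleftrightarrow>
     filtration (space P) F \<and>
     (\<forall>t. subalgebra P (F t)) \<and>
     (\<forall>t\<ge>1. X t \<in> borel_measurable (F t)) \<and>
     (\<forall>t\<ge>1. Y t \<in> borel_measurable (F (Suc t))) \<and>
     (\<forall>t\<ge>1. \<forall>w\<in>space P. X t w \<in> \<X>) \<and>
     (\<forall>t\<ge>1. has_cond_distr P (F t) (Y t) (\<lambda>w. tilted Q (X t w \<bullet> \<theta>s)))"

definition wnorm :: "real ^ 'd ^ 'd \<Rightarrow> real ^ 'd \<Rightarrow> real" where
  "wnorm A v = sqrt (v \<bullet> (A *v v))"

definition theta_hat ::
    "real measure \<Rightarrow> real \<Rightarrow> (nat \<Rightarrow> real ^ 'd) \<Rightarrow> (nat \<Rightarrow> real) \<Rightarrow> nat \<Rightarrow> real ^ 'd" where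
  "theta_hat Q lam x y t =
     arg_min (\<lambda>\<theta>. lam / 2 * (norm \<theta>)\<^sup>2 - (\<Sum>i=1..t. y i * (x i \<bullet> \<theta>) - psi Q (x i \<bullet> \<theta>))) (\<lambda>_. True)"

definition g :: "real measure \<Rightarrow> real \<Rightarrow> (nat \<Rightarrow> real ^ 'd) \<Rightarrow> nat \<Rightarrow> real ^ 'd \<Rightarrow> real ^ 'd" where
  "g Q lam x t \<theta> = (\<Sum>i=1..t. mu Q (x i \<bullet> \<theta>) *\<^sub>R x i) + lam *\<^sub>R \<theta>"

definition H ::
    "real measure \<Rightarrow> real \<Rightarrow> real ^ 'd \<Rightarrow> (nat \<Rightarrow> real ^ 'd) \<Rightarrow> nat \<Rightarrow> real ^ 'd ^ 'd" where
  "H Q lam \<theta>s x t =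
     (\<Sum>i=1..t. deriv (mu Q) (x i \<bullet> \<theta>s) *\<^sub>R ((columnvector (x i) :: real ^ 1 ^ 'd) ** rowvector (x i)))
     + lam *\<^sub>R mat 1"

definition gamma ::
    "nat \<Rightarrow> real \<Rightarrow> real \<Rightarrow> real \<Rightarrow> real \<Rightarrow> real \<Rightarrow> nat \<Rightarrow> real" where
  "gamma d L M S del lam t =
     sqrt lam * (1 / (2 * M) + S)
     + 2 * M * real d / sqrt lam * (1 + 1 / 2 * ln (1 + real t * L / (lam * real d)))
     + 2 * M / sqrt lam * ln (1 / del)"

definition confidence_event ::
    "'w measure \<Rightarrow> real measure \<Rightarrow> real \<Rightarrow> real \<Rightarrow> real \<Rightarrow> real ^ 'd \<Rightarrow>
     (nat \<Rightarrow> 'w \<Rightarrow> real ^ 'd) \<Rightarrow> (nat \<Rightarrow> 'w \<Rightarrow> real) \<Rightarrow> real \<Rightarrow> real \<Rightarrow> 'w set" where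
  "confidence_event P Q L M S \<theta>s X Y del lam =
     {w \<in> space P. \<forall>t.
        (let x = (\<lambda>i. X i w); y = (\<lambda>i. Y i w) in
         wnorm (matrix_inv (H Q lam \<theta>s x t))
           (g Q lam x t (theta_hat Q lam x y t) - g Q lam x t \<theta>s)
         \<le> gamma CARD('d) L M S del lam t)}"

end

theory Submission
  imports Defs
begin

text \<open>The first-order condition at the estimator gives \<open>g\<^sub>t(\<theta>\<^sub>t) - g\<^sub>t(\<theta>\<^sub>s) = S\<^sub>t - \<lambda> \<theta>\<^sub>s\<close>, where \<open>S\<^sub>t\<close>
  is the sum of the \<open>(Y\<^sub>i - \<mu>(X\<^sub>i \<bullet> \<theta>\<^sub>s)) X\<^sub>i\<close>. Self-concordance yields a Bernstein bound on the
  conditional moment generating function, so that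
  \<open>exp(\<xi> \<bullet> S\<^sub>t - \<Sum> \<mu>'(X\<^sub>i \<bullet> \<theta>\<^sub>s) (\<xi> \<bullet> X\<^sub>i)\<^sup>2)\<close> is a supermartingale for every \<open>\<xi>\<close> of norm at most
  \<open>1/M\<close>. Mixing it over \<open>\<xi>\<close> with a Gaussian weight truncated to that ball and applying Ville's
  inequality bounds the mixture uniformly in \<open>t\<close>. Conversely, the mixture dominates the integrand
  at any \<open>\<xi>\<close> of norm at most \<open>1/(2M)\<close> up to a factor controlled by the dimension and the trace
  of \<open>H\<^sub>t\<close>; the bound follows by choosing \<open>\<xi>\<close> proportional to
  \<open>H\<^sub>t\<^sup>-\<^sup>1(S\<^sub>t - \<lambda> \<theta>\<^sub>s)\<close>.\<close>

subsection \<open>Cumulant functions and self-concordance\<close>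

text \<open>The Bernstein bound holds only for steps \<open>s\<close> with
  \<open>M * \<bar>s\<bar> \<le> 1\<close>, so the mixture must live on a ball and the closed form
  of a full Gaussian integral is lost. The Gaussian mass of a ball is therefore never evaluated: it
  is compared with itself under scaling by 2 and cancels. The price is a factor
  \<open>2 ^ d\<close>, which enters the exponent as \<open>d * ln 2\<close> and is rounded up to
  the summand \<open>d\<close> in \<open>gamma\<close>. With Bernstein constant 1 and Gaussian
  exponent \<open>lam * (norm \<xi>)\<^sup>2\<close> the quadratic terms add up to exactly the
  quadratic form of \<open>H\<close> at \<xi>. The unconstrained maximiser of the resulting concave
  quadratic may leave the ball, so the test vector is instead scaled to have \<open>H\<close>-norm
  \<open>sqrt lam / (2 * M)\<close>; as \<open>H\<close> dominates \<open>lam\<close> times the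
  identity, its Euclidean norm is then at most \<open>1 / (2 * M)\<close>. Dividing by this fixed
  \<open>H\<close>-norm is the origin of the factors \<open>2 * M / sqrt lam\<close> and
  \<open>sqrt lam / (2 * M)\<close>, and the reason why \<open>ln (1 / del)\<close> enters linearly
  and not under a square root.\<close>

lemma power_le_fact_exp:
  fixes y :: real
  shows "\<bar>y\<bar> ^ k \<le> fact k * exp \<bar>y\<bar>"
proof -
  have "(\<Sum>n\<in>{k}. \<bar>y\<bar> ^ n /\<^sub>R fact n) \<le> (\<Sum>n. \<bar>y\<bar> ^ n /\<^sub>R fact n)"
    by (rule sum_le_suminf[OF summable_exp_generic]) simp_all
  then have "\<bar>y\<bar> ^ k /\<^sub>R fact k \<le> exp \<bar>y\<bar>"
    by (simp add: exp_def)
  then show ?thesis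
    by (simp add: divide_simps mult.commute)
qed

locale exp_family = real_distribution Q for Q :: "real measure" +
  assumes integrable_exp: "\<And>u. integrable Q (\<lambda>y. exp (u * y))"
begin

text \<open>The \<open>k\<close>-th derivative of the moment generating function, left unnormalised
  so that differentiating only raises \<open>k\<close>. Then \<open>mu Q\<close> and its derivative
  are quotients of such functions with positive denominator, hence differentiable again.\<close>

definition mom :: "nat \<Rightarrow> real \<Rightarrow> real" where
  "mom k u = (\<integral>y. y ^ k * exp (u * y) \<partial>Q)"

text \<open>The extra \<open>exp \<bar>y\<bar>\<close> leaves room for perturbing \<open>u\<close>
  by less than 1, so this function dominates the difference quotients in \<open>mom_deriv\<close>. A
  power of \<open>\<bar>y\<bar>\<close> costs one more \<open>exp \<bar>y\<bar>\<close>, and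
  \<open>exp (u * y + 2 * \<bar>y\<bar>)\<close> is at most the sum of the exponentials with
  parameters \<open>u + 2\<close> and \<open>u - 2\<close>.\<close>

lemma integrable_abs_power_exp: "integrable Q (\<lambda>y. \<bar>y\<bar> ^ k * exp (u * y + \<bar>y\<bar>))"
proof (rule Bochner_Integration.integrable_bound)
  show "integrable Q (\<lambda>y. fact k * (exp ((u + 2) * y) + exp ((u - 2) * y)))"
    by (intro integrable_mult_right Bochner_Integration.integrable_add integrable_exp)
  have "\<bar>y\<bar> ^ k * exp (u * y + \<bar>y\<bar>) \<le> fact k * (exp ((u + 2) * y) + exp ((u - 2) * y))" for y :: real
  proof -
    have "\<bar>y\<bar> ^ k * exp (u * y + \<bar>y\<bar>) \<le> fact k * exp \<bar>y\<bar> * exp (u * y + \<bar>y\<bar>)"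
      by (intro mult_right_mono power_le_fact_exp) auto
    also have "\<dots> = fact k * exp (u * y + 2 * \<bar>y\<bar>)"
      by (simp only: mult.assoc exp_add[symmetric] mult_cancel_left) simp
    also have "exp (u * y + 2 * \<bar>y\<bar>) \<le> exp ((u + 2) * y) + exp ((u - 2) * y)"
      by (cases "y \<ge> 0") (auto simp: algebra_simps)
    finally show ?thesis by simp
  qed
  then show "AE y in Q. norm (\<bar>y\<bar> ^ k * exp (u * y + \<bar>y\<bar>))
      \<le> norm (fact k * (exp ((u + 2) * y) + exp ((u - 2) * y)))"
    by (auto intro!: AE_I2)
qed auto

lemma integrable_power_exp: "integrable Q (\<lambda>y. y ^ k * exp (u * y))"
  by (rule Bochner_Integration.integrable_bound[OF integrable_abs_power_exp[of k u]])
     (auto intro!: AE_I2 mult_left_mono simp: abs_mult power_abs)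

lemma mom_deriv: "(mom k has_real_derivative mom (Suc k) u) (at u)"
proof -
  have "((\<lambda>h. (mom k (u + h) - mom k u) / h) \<longlongrightarrow> mom (Suc k) u) (at 0)"
    unfolding tendsto_at_iff_sequentially comp_def
  proof (intro allI impI)
    fix h :: "nat \<Rightarrow> real"
    assume h: "\<forall>n. h n \<in> UNIV - {0}" and lim: "h \<longlonglongrightarrow> 0"
    from lim have "eventually (\<lambda>n. \<bar>h n\<bar> < 1) sequentially"
      using order_tendstoD(2)[OF tendsto_rabs_zero[OF lim], of 1] by simp
    then obtain N where N: "\<And>n. n \<ge> N \<Longrightarrow> \<bar>h n\<bar> < 1"
      by (auto simp: eventually_sequentially)
    \<comment> \<open>The integrand of the difference quotient. The shift by \<open>N\<close> puts
      every increment, not only all but finitely many, below 1 in absolute value, as the domination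
      requires.\<close>
    define s where "s n y = y ^ k * exp (u * y) * ((exp (h (n + N) * y) - 1) / h (n + N))" for n y
    have nz: "h n \<noteq> 0" for n using h by auto
    have eq: "(mom k (u + h (n + N)) - mom k u) / h (n + N) = (\<integral>y. s n y \<partial>Q)" for n
    proof -
      have "mom k (u + h (n + N)) - mom k u
          = (\<integral>y. y ^ k * exp ((u + h (n + N)) * y) - y ^ k * exp (u * y) \<partial>Q)"
        unfolding mom_def by (rule Bochner_Integration.integral_diff[symmetric]) (rule integrable_power_exp)+
      then have "(mom k (u + h (n + N)) - mom k u) / h (n + N)
          = (\<integral>y. (y ^ k * exp ((u + h (n + N)) * y) - y ^ k * exp (u * y)) / h (n + N) \<partial>Q)"
        by simp
      also have "\<dots> = (\<integral>y. s n y \<partial>Q)"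
        by (rule Bochner_Integration.integral_cong) (auto simp: s_def distrib_right exp_add algebra_simps diff_divide_distrib)
      finally show ?thesis .
    qed
    have "(\<lambda>n. \<integral>y. s n y \<partial>Q) \<longlonglongrightarrow> (\<integral>y. y ^ Suc k * exp (u * y) \<partial>Q)"
    proof (rule integral_dominated_convergence)
      show "integrable Q (\<lambda>y. \<bar>y\<bar> ^ Suc k * exp (u * y + \<bar>y\<bar>))"
        by (rule integrable_abs_power_exp)
      show "AE y in Q. (\<lambda>n. s n y) \<longlonglongrightarrow> y ^ Suc k * exp (u * y)"
      proof (intro AE_I2)
        fix y :: real
        have "((\<lambda>x. exp (x * y)) has_real_derivative y) (at 0)"
          by (auto intro!: derivative_eq_intros)
        then have "((\<lambda>x. (exp (x * y) - 1) / x) \<longlongrightarrow> y) (at 0)"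
          by (simp add: DERIV_def)
        then have "(\<lambda>n. (exp (h (n + N) * y) - 1) / h (n + N)) \<longlonglongrightarrow> y"
          unfolding tendsto_at_iff_sequentially comp_def
          using nz LIMSEQ_ignore_initial_segment[OF lim, of N] by auto
        then have "(\<lambda>n. s n y) \<longlonglongrightarrow> y ^ k * exp (u * y) * y"
          unfolding s_def by (intro tendsto_intros)
        then show "(\<lambda>n. s n y) \<longlonglongrightarrow> y ^ Suc k * exp (u * y)"
          by (simp add: mult_ac)
      qed
      have "\<bar>s n y\<bar> \<le> \<bar>y\<bar> ^ Suc k * exp (u * y + \<bar>y\<bar>)" for n y
      proof -
        have "\<bar>exp x - 1\<bar> \<le> \<bar>x\<bar> * exp \<bar>x\<bar>" for x :: real
        proof (cases "x \<ge> 0")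
          case True
          have "exp x * (1 - x) \<le> exp x * exp (- x)"
            using exp_ge_add_one_self[of "- x"] by (intro mult_left_mono) auto
          then have "exp x - 1 \<le> x * exp x"
            unfolding exp_minus_inverse by (simp add: right_diff_distrib mult.commute)
          with True show ?thesis by simp
        next
          case False
          have "1 - exp x \<le> - x * 1" using exp_ge_add_one_self[of x] by linarith
          also have "\<dots> \<le> - x * exp (- x)" using False by (intro mult_left_mono) auto
          finally have "1 - exp x \<le> - x * exp (- x)" .
          moreover have "exp x < 1" using False by simp
          ultimately show ?thesis using False by (simp only: abs_of_neg diff_less_0_iff_less not_le minus_diff_eq)
        qed
        from this[of "h (n + N) * y"]
        have "\<bar>(exp (h (n + N) * y) - 1) / h (n + N)\<bar> \<le> \<bar>y\<bar> * exp \<bar>h (n + N) * y\<bar>"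
          using nz[of "n + N"] by (simp add: abs_mult field_simps)
        also have "\<dots> \<le> \<bar>y\<bar> * exp \<bar>y\<bar>"
          using N[of "n + N"] by (intro mult_left_mono) (auto simp: abs_mult intro!: mult_left_le_one_le)
        finally have "\<bar>(exp (h (n + N) * y) - 1) / h (n + N)\<bar> \<le> \<bar>y\<bar> * exp \<bar>y\<bar>" .
        then have "\<bar>s n y\<bar> \<le> \<bar>y ^ k * exp (u * y)\<bar> * (\<bar>y\<bar> * exp \<bar>y\<bar>)"
          unfolding s_def abs_mult[of "y ^ k * exp (u * y)"] by (rule mult_left_mono) simp
        then show ?thesis by (simp add: exp_add abs_mult power_abs mult_ac)
      qed
      then show "AE y in Q. norm (s n y) \<le> \<bar>y\<bar> ^ Suc k * exp (u * y + \<bar>y\<bar>)" for n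
        by simp
    qed (auto simp: s_def)
    then have "(\<lambda>n. (mom k (u + h (n + N)) - mom k u) / h (n + N)) \<longlonglongrightarrow> mom (Suc k) u"
      unfolding eq by (simp only: mom_def)
    then show "(\<lambda>n. (mom k (u + h n) - mom k u) / h n) \<longlonglongrightarrow> mom (Suc k) u"
      by (rule LIMSEQ_offset)
  qed
  then show ?thesis by (simp add: DERIV_def)
qed

lemma mom_0_pos: "mom 0 u > 0"
proof -
  have "mom 0 u \<noteq> 0"
  proof
    assume "mom 0 u = 0"
    then have "AE y in Q. exp (u * y) = (0::real)"
      using integral_nonneg_eq_0_iff_AE[OF integrable_exp[of u]] by (simp add: mom_def)
    then show False by (simp add: AE_False)
  qed
  moreover have "mom 0 u \<ge> 0" by (simp add: mom_def)
  ultimately show ?thesis by simp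
qed

lemma psi_eq: "psi Q = (\<lambda>u. ln (mom 0 u))"
  by (simp add: psi_def mom_def fun_eq_iff)

lemma exp_psi: "exp (psi Q u) = (\<integral>y. exp (u * y) \<partial>Q)"
  using mom_0_pos[of u] by (simp add: psi_def mom_def)

lemma nn_integral_exp: "(\<integral>\<^sup>+y. ennreal (exp (u * y)) \<partial>Q) = ennreal (exp (psi Q u))"
  unfolding exp_psi by (intro nn_integral_eq_integral integrable_exp) auto

lemma psi_0: "psi Q 0 = 0"
  by (simp add: psi_def prob_space space_eq_univ[symmetric] del: space_eq_univ)

lemma mu_eq: "mu Q = (\<lambda>u. mom 1 u / mom 0 u)"
  unfolding mu_def psi_eq using mom_0_pos less_imp_neq[OF mom_0_pos]
  by (auto intro!: ext DERIV_imp_deriv derivative_eq_intros mom_deriv[of 0, simplified] simp: field_simps)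

lemma deriv_mu_eq: "deriv (mu Q) = (\<lambda>u. (mom 2 u * mom 0 u - mom 1 u * mom 1 u) / (mom 0 u * mom 0 u))"
  unfolding mu_eq using less_imp_neq[OF mom_0_pos]
  by (auto intro!: ext DERIV_imp_deriv derivative_eq_intros mom_deriv[of 0, simplified]
      mom_deriv[of 1, simplified] simp: numeral_2_eq_2)

lemma psi_deriv: "(psi Q has_real_derivative mu Q u) (at u)"
  unfolding mu_eq unfolding psi_eq using mom_0_pos less_imp_neq[OF mom_0_pos]
  by (auto intro!: derivative_eq_intros mom_deriv[of 0, simplified] simp: field_simps)

lemma mu_deriv: "(mu Q has_real_derivative deriv (mu Q) u) (at u)"
  unfolding deriv_mu_eq unfolding mu_eq using less_imp_neq[OF mom_0_pos]
  by (auto intro!: derivative_eq_intros mom_deriv[of 0, simplified]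
      mom_deriv[of 1, simplified] simp: numeral_2_eq_2)

lemma deriv_mu_deriv: "(deriv (mu Q) has_real_derivative deriv (deriv (mu Q)) u) (at u)"
proof -
  have "\<exists>D. (deriv (mu Q) has_real_derivative D) (at u)"
    unfolding deriv_mu_eq using less_imp_neq[OF mom_0_pos]
    by (intro exI) (rule derivative_eq_intros mom_deriv refl | simp)+
  then show ?thesis
    using DERIV_imp_deriv by blast
qed

end

section \<open>Self-concordance and the Bernstein bound\<close>

lemma self_concordant_growth:
  fixes f :: "real \<Rightarrow> real"
  assumes f: "\<And>r. (f has_real_derivative f' r) (at r)" and M: "\<And>r. \<bar>f' r\<bar> \<le> M * f r"
    and "r \<ge> 0"
  shows "f r \<le> f 0 * exp (M * r)"
proof -
  \<comment> \<open>Gronwall's argument: since \<open>f' \<le> M * f\<close>, discounting by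
    \<open>exp (- (M * r))\<close> makes \<open>f\<close> non-increasing.\<close>
  have "f r * exp (- (M * r)) \<le> f 0 * exp (- (M * 0))"
  proof (rule DERIV_nonpos_imp_nonincreasing[OF \<open>r \<ge> 0\<close>])
    fix x
    have "((\<lambda>x. f x * exp (- (M * x))) has_real_derivative (f' x - M * f x) * exp (- (M * x))) (at x)"
      by (auto intro!: derivative_eq_intros f simp: algebra_simps)
    moreover have "(f' x - M * f x) * exp (- (M * x)) \<le> 0"
      using M[of x] by (intro mult_nonpos_nonneg) auto
    ultimately show "\<exists>y. ((\<lambda>x. f x * exp (- (M * x))) has_real_derivative y) (at x) \<and> y \<le> 0"
      by blast
  qed
  then show ?thesis
    by (simp add: exp_minus field_simps)
qed

text \<open>The function \<open>f'' 0 * (exp (M * r) - M * r - 1) / M\<^sup>2\<close> vanishes to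
  first order at 0, like the Taylor remainder on the left, and its second derivative
  \<open>f'' 0 * exp (M * r)\<close> dominates \<open>f''\<close> by
  \<open>self_concordant_growth\<close>.\<close>

lemma self_concordant_bound:
  fixes f :: "real \<Rightarrow> real"
  assumes f: "\<And>r. (f has_real_derivative f' r) (at r)"
    and f': "\<And>r. (f' has_real_derivative f'' r) (at r)"
    and f'': "\<And>r. (f'' has_real_derivative f''' r) (at r)"
    and sc: "\<And>r. \<bar>f''' r\<bar> \<le> M * f'' r"
    and "M > 0" "s \<ge> 0" "M * s \<le> 1"
  shows "f s - f 0 - s * f' 0 \<le> f'' 0 * s\<^sup>2"
proof (cases "s = 0")
  case False
  with \<open>s \<ge> 0\<close> have "s > 0" by simp
  \<comment> \<open>\<open>D 0\<close> is the comparison function minus the Taylor remainder; the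
    other two are its derivatives. \<open>D 0\<close> and \<open>D 1\<close> vanish at 0, so only
    the second-order Lagrange term survives in Maclaurin's formula.\<close>
  define D where "D m = (if m = 0 then (\<lambda>r. f'' 0 * (exp (M * r) - M * r - 1) / M\<^sup>2 - (f r - f 0 - r * f' 0))
    else if m = 1 then (\<lambda>r. f'' 0 * (exp (M * r) - 1) / M - (f' r - f' 0))
    else (\<lambda>r. f'' 0 * exp (M * r) - f'' r))" for m :: nat
  have "\<exists>t. 0 < t \<and> t \<le> s \<and> D 0 s = (\<Sum>m<2. D m 0 / (fact m) * s ^ m) + D 2 t / fact 2 * s ^ 2"
  proof (rule Maclaurin2[OF \<open>s > 0\<close>]; safe?)
    fix m :: nat and t assume "m < 2"
    then consider "m = 0" | "m = 1" by linarith
    then show "(D m has_real_derivative D (Suc m) t) (at t)"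
      using \<open>M > 0\<close> by cases (auto simp: D_def power2_eq_square field_simps intro!: derivative_eq_intros f f')
  qed
  then obtain t where t: "0 < t" "D 0 s = D 2 t / 2 * s ^ 2"
    by (auto simp: D_def numeral_2_eq_2)
  have "D 2 t \<ge> 0"
    using self_concordant_growth[OF f'' sc, of t] t by (simp add: D_def)
  then have "D 0 s \<ge> 0" by (simp add: t)
  then have "f s - f 0 - s * f' 0 \<le> f'' 0 * (exp (M * s) - M * s - 1) / M\<^sup>2"
    by (simp add: D_def)
  also have "\<dots> \<le> f'' 0 * (M * s)\<^sup>2 / M\<^sup>2"
  proof (intro divide_right_mono mult_left_mono)
    show "f'' 0 \<ge> 0"
      using order.trans[OF abs_ge_zero sc, of 0] \<open>M > 0\<close> by (simp add: zero_le_mult_iff)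
    \<comment> \<open>The restriction \<open>M * s \<le> 1\<close> is spent here:
      \<open>exp x \<le> 1 + x + x\<^sup>2\<close> for \<open>x\<close> between 0 and 1.\<close>
    show "exp (M * s) - M * s - 1 \<le> (M * s)\<^sup>2"
      using exp_bound[of "M * s"] assms by simp
  qed simp
  also have "\<dots> = f'' 0 * s\<^sup>2"
    using \<open>M > 0\<close> by (simp add: power_mult_distrib)
  finally show ?thesis .
qed simp

text \<open>The left side is the logarithm of the moment generating function, at \<open>s\<close>,
  of an observation with law \<open>tilted Q u\<close> centred at its mean
  \<open>mu Q u\<close>.\<close>

lemma (in exp_family) psi_bernstein:
  assumes sc: "\<And>u. \<bar>deriv (deriv (mu Q)) u\<bar> \<le> M * deriv (mu Q) u"
    and "M > 0" "M * \<bar>s\<bar> \<le> 1"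
  shows "psi Q (u + s) - psi Q u - s * mu Q u \<le> deriv (mu Q) u * s\<^sup>2"
proof (cases "s \<ge> 0")
  case True
  have "psi Q (u + s) - psi Q (u + 0) - s * mu Q (u + 0) \<le> deriv (mu Q) (u + 0) * s\<^sup>2"
  proof (rule self_concordant_bound[where f = "\<lambda>r. psi Q (u + r)" and M = M
        and f''' = "\<lambda>r. deriv (deriv (mu Q)) (u + r)"])
    fix r
    have "((\<lambda>r. u + r) has_real_derivative 1) (at r)"
      by (auto intro!: derivative_eq_intros)
    from DERIV_chain2[OF psi_deriv this] DERIV_chain2[OF mu_deriv this]
      DERIV_chain2[OF deriv_mu_deriv this]
    show "((\<lambda>r. psi Q (u + r)) has_real_derivative mu Q (u + r)) (at r)"
      "((\<lambda>r. mu Q (u + r)) has_real_derivative deriv (mu Q) (u + r)) (at r)"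
      "((\<lambda>r. deriv (mu Q) (u + r)) has_real_derivative deriv (deriv (mu Q)) (u + r)) (at r)"
      by (simp_all only: mult_1_right mult_minus_right minus_minus)
  qed (use assms True in auto)
  then show ?thesis by simp
next
  case False
  \<comment> \<open>For negative \<open>s\<close> the one-sided bound is applied to the reflection
    about \<open>u\<close>. Odd derivatives change sign, but \<open>sc\<close> controls the third
    one in absolute value.\<close>
  have "psi Q (u - (- s)) - psi Q (u - 0) - (- s) * - mu Q (u - 0) \<le> deriv (mu Q) (u - 0) * (- s)\<^sup>2"
  proof (rule self_concordant_bound[where f = "\<lambda>r. psi Q (u - r)" and M = M
        and f''' = "\<lambda>r. - deriv (deriv (mu Q)) (u - r)"])
    fix r
    have "((\<lambda>r. u - r) has_real_derivative - 1) (at r)"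
      by (auto intro!: derivative_eq_intros)
    from DERIV_chain2[OF psi_deriv this] DERIV_minus[OF DERIV_chain2[OF mu_deriv this]]
      DERIV_chain2[OF deriv_mu_deriv this]
    show "((\<lambda>r. psi Q (u - r)) has_real_derivative - mu Q (u - r)) (at r)"
      "((\<lambda>r. - mu Q (u - r)) has_real_derivative deriv (mu Q) (u - r)) (at r)"
      "((\<lambda>r. deriv (mu Q) (u - r)) has_real_derivative - deriv (deriv (mu Q)) (u - r)) (at r)"
      by (simp_all only: mult_1_right mult_minus_right minus_minus)
  qed (use assms False in auto)
  then show ?thesis by simp
qed

subsection \<open>Ville's inequality and conditional distributions\<close>

text \<open>The induction runs on the expectation of the process stopped at its first exceedance
  of \<open>c\<close> and truncated there to \<open>c\<close>.\<close>

lemma ville_inequality: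
  fixes Z :: "nat \<Rightarrow> 'w \<Rightarrow> ennreal"
  assumes sub: "\<And>n. subalgebra P (F n)"
    and mono: "\<And>m n. m \<le> n \<Longrightarrow> sets (F m) \<subseteq> sets (F n)"
    and Z: "\<And>n. Z n \<in> borel_measurable (F n)"
    and super: "\<And>n B. B \<in> sets (F n) \<Longrightarrow>
      (\<integral>\<^sup>+w. indicator B w * Z (Suc n) w \<partial>P) \<le> (\<integral>\<^sup>+w. indicator B w * Z n w \<partial>P)"
  shows "c * emeasure P {w \<in> space P. \<exists>n. c < Z n w} \<le> (\<integral>\<^sup>+w. Z 0 w \<partial>P)"
proof -
  have ZP [measurable]: "Z n \<in> borel_measurable P" for n
    using measurable_from_subalg[OF sub Z] .
  have sp: "space (F n) = space P" for n
    using sub[of n] by (simp add: subalgebra_def)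
  define A where "A n = {w \<in> space P. \<exists>k\<le>n. c < Z k w}" for n
  have AF: "A n \<in> sets (F n)" for n
  proof -
    have "{w \<in> space (F k). c < Z k w} \<in> sets (F k)" for k
      using Z[of k] by measurable
    then have "(\<Union>k\<le>n. {w \<in> space (F k). c < Z k w}) \<in> sets (F n)"
      using mono by (intro sets.finite_UN) auto
    also have "(\<Union>k\<le>n. {w \<in> space (F k). c < Z k w}) = A n"
      by (auto simp: A_def sp)
    finally show ?thesis .
  qed
  have AP [measurable]: "A n \<in> sets P" for n
    using AF[of n] sub[of n] by (auto simp: subalgebra_def)
  have *: "c * emeasure P (A n) + (\<integral>\<^sup>+w. indicator (space P - A n) w * Z n w \<partial>P) \<le> (\<integral>\<^sup>+w. Z 0 w \<partial>P)" for n
  proof (induction n)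
    case 0
    have "c * emeasure P (A 0) + (\<integral>\<^sup>+w. indicator (space P - A 0) w * Z 0 w \<partial>P)
        = (\<integral>\<^sup>+w. c * indicator (A 0) w + indicator (space P - A 0) w * Z 0 w \<partial>P)"
      by (simp add: nn_integral_add nn_integral_cmult_indicator)
    also have "\<dots> \<le> (\<integral>\<^sup>+w. Z 0 w \<partial>P)"
      by (rule nn_integral_mono) (auto simp: A_def indicator_def)
    finally show ?case .
  next
    case (Suc n)
    have sub': "A n \<subseteq> A (Suc n)" by (auto simp: A_def intro: le_SucI)
    have "c * emeasure P (A (Suc n)) + (\<integral>\<^sup>+w. indicator (space P - A (Suc n)) w * Z (Suc n) w \<partial>P)
        = (\<integral>\<^sup>+w. c * indicator (A (Suc n)) w + indicator (space P - A (Suc n)) w * Z (Suc n) w \<partial>P)"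
      by (simp add: nn_integral_add nn_integral_cmult_indicator)
    \<comment> \<open>A path that first crosses at time \<open>Suc n\<close> is credited
      \<open>c\<close>, which is less than its current value.\<close>
    also have "\<dots> \<le> (\<integral>\<^sup>+w. c * indicator (A n) w + indicator (space P - A n) w * Z (Suc n) w \<partial>P)"
    proof (rule nn_integral_mono)
      fix w assume w: "w \<in> space P"
      consider "w \<in> A n" | "w \<notin> A n" "w \<in> A (Suc n)" | "w \<notin> A n" "w \<notin> A (Suc n)" by blast
      then show "c * indicator (A (Suc n)) w + indicator (space P - A (Suc n)) w * Z (Suc n) w
          \<le> c * indicator (A n) w + indicator (space P - A n) w * Z (Suc n) w"
      proof cases
        case 2
        then have "c < Z (Suc n) w" by (auto simp: A_def le_Suc_eq)
        with 2 w show ?thesis by simp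
      qed (use w sub' in auto)
    qed
    also have "\<dots> = c * emeasure P (A n) + (\<integral>\<^sup>+w. indicator (space P - A n) w * Z (Suc n) w \<partial>P)"
      by (simp add: nn_integral_add nn_integral_cmult_indicator)
    \<comment> \<open>Not having crossed by time \<open>n\<close> is an event of \<open>F n\<close>,
      so the supermartingale inequality may be used on it.\<close>
    also have "\<dots> \<le> c * emeasure P (A n) + (\<integral>\<^sup>+w. indicator (space P - A n) w * Z n w \<partial>P)"
      using super[of "space P - A n" n] sets.compl_sets[OF AF[of n]] by (simp add: sp add_left_mono)
    finally show ?case using Suc.IH by (rule order.trans)
  qed
  have "(SUP n. emeasure P (A n)) = emeasure P (\<Union>n. A n)"
    by (intro SUP_emeasure_incseq) (auto simp: incseq_def A_def intro: order.trans)
  also have "(\<Union>n. A n) = {w \<in> space P. \<exists>n. c < Z n w}"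
    by (auto simp: A_def)
  finally have "c * emeasure P {w \<in> space P. \<exists>n. c < Z n w} = (SUP n. c * emeasure P (A n))"
    by (simp flip: SUP_mult_left_ennreal)
  also have "\<dots> \<le> (\<integral>\<^sup>+w. Z 0 w \<partial>P)"
    using * by (intro SUP_least) (meson add_increasing2 order.trans le_add_same_cancel1 zero_le add_decreasing2 le_iff_add)
  finally show ?thesis .
qed

text \<open>\<open>has_cond_distr\<close> speaks of events in \<open>Y\<close> alone; this extends
  it to functions of the past and \<open>Y\<close> jointly. The law of \<open>(w, Y w)\<close> and
  the measure with density \<open>k\<close> against the product of \<open>P\<close> (restricted to
  \<open>F\<close>) and \<open>Q\<close> agree on rectangles, an intersection-stable generator,
  hence everywhere; Tonelli then gives the formula.\<close>

lemma has_cond_distr_density: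
  fixes k :: "'w \<Rightarrow> real \<Rightarrow> ennreal"
  assumes "prob_space P" and sub: "subalgebra P F" and Q: "sigma_finite_measure Q" "sets Q = sets borel"
    and k: "(\<lambda>(w, y). k w y) \<in> borel_measurable (F \<Otimes>\<^sub>M borel)"
    and K: "\<And>w. w \<in> space P \<Longrightarrow> K w = density Q (k w)" "\<And>w. w \<in> space P \<Longrightarrow> prob_space (K w)"
    and cd: "has_cond_distr P F Y K"
    and f: "f \<in> borel_measurable (F \<Otimes>\<^sub>M borel)"
  shows "(\<integral>\<^sup>+w. f (w, Y w) \<partial>P) = (\<integral>\<^sup>+w. (\<integral>\<^sup>+y. k w y * f (w, y) \<partial>Q) \<partial>P)"
proof -
  interpret P: prob_space P by fact
  interpret sigma_finite_subalgebra P F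
    by (rule finite_measure_subalgebra_is_sigma_finite) (unfold_locales, fact)
  interpret Q: sigma_finite_measure Q by fact
  \<comment> \<open>Restricting \<open>P\<close> to \<open>F\<close> makes the sigma-algebra of the
    product with \<open>Q\<close> the one on which \<open>k\<close> and \<open>f\<close> are known
    to be measurable.\<close>
  let ?PF = "restr_to_subalg P F"
  interpret PF: prob_space ?PF
    using prob_space_restr_to_subalg[OF sub \<open>prob_space P\<close>] .
  note Q(2) [measurable_cong]
  have Y [measurable]: "Y \<in> borel_measurable P"
    using cd by (simp add: has_cond_distr_def)
  have id [measurable]: "(\<lambda>w. w) \<in> P \<rightarrow>\<^sub>M F"
    using sub by (auto simp: subalgebra_def measurable_def)
  have sp: "space F = space P" "sets F \<subseteq> sets P" using sub by (auto simp: subalgebra_def)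
  have sets_eq: "sets (?PF \<Otimes>\<^sub>M Q) = sets (F \<Otimes>\<^sub>M borel)"
    by (intro sets_pair_measure_cong) (simp_all add: Q(2) sets_restr_to_subalg sub)
  have meas_eq: "borel_measurable (?PF \<Otimes>\<^sub>M Q) = (borel_measurable (F \<Otimes>\<^sub>M borel) :: ('w \<times> real \<Rightarrow> ennreal) set)"
    by (rule measurable_cong_sets[OF sets_eq refl])
  have k' [measurable]: "(\<lambda>z. k (fst z) (snd z)) \<in> borel_measurable (?PF \<Otimes>\<^sub>M Q)"
    using k unfolding meas_eq by (simp add: case_prod_beta')
  have kF [measurable]: "(\<lambda>z. k (fst z) (snd z)) \<in> borel_measurable (F \<Otimes>\<^sub>M Q)"
    using k by (simp add: case_prod_beta' cong: measurable_cong_sets)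
  have YF: "(\<lambda>w. (w, Y w)) \<in> P \<rightarrow>\<^sub>M (F \<Otimes>\<^sub>M borel)" by measurable
  define N where "N = density (?PF \<Otimes>\<^sub>M Q) (\<lambda>z. k (fst z) (snd z))"
  define N' where "N' = distr P (F \<Otimes>\<^sub>M borel) (\<lambda>w. (w, Y w))"
  have rect: "emeasure N' (A \<times> B) = emeasure N (A \<times> B)" if A: "A \<in> sets F" and B: "B \<in> sets borel" for A B
  proof -
    have AP [measurable]: "A \<in> sets P" using A sp by auto
    note B [measurable]
    have BQ [measurable]: "B \<in> sets Q" using B Q by simp
    have ABPF: "A \<times> B \<in> sets (?PF \<Otimes>\<^sub>M Q)"
      using A B unfolding sets_eq by auto
    have K_int: "(\<integral>\<^sup>+y. k w y * indicator B y \<partial>Q) = ennreal (measure (K w) B)" if w: "w \<in> space P" for w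
    proof -
      interpret K: prob_space "K w" using K(2)[OF w] .
      have "(\<lambda>y. k (fst (w, y)) (snd (w, y))) \<in> borel_measurable Q"
        by (rule measurable_compose[OF measurable_Pair1' kF]) (use w sp in simp)
      then have "emeasure (K w) B = (\<integral>\<^sup>+y. k w y * indicator B y \<partial>Q)"
        unfolding K(1)[OF w] by (intro emeasure_density) (simp_all add: BQ)
      then show ?thesis by (simp add: K.emeasure_eq_measure)
    qed
    have ind: "integrable P (\<lambda>w. indicator B (Y w) :: real)"
      by (rule P.integrable_const_bound[where B = 1]) auto
    have "emeasure N' (A \<times> B) = emeasure P ((\<lambda>w. (w, Y w)) -` (A \<times> B) \<inter> space P)"
      unfolding N'_def using A B by (intro emeasure_distr YF) auto
    also have "(\<lambda>w. (w, Y w)) -` (A \<times> B) \<inter> space P = {w \<in> space P. w \<in> A \<and> Y w \<in> B}"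
      by auto
    also have "emeasure P \<dots> = ennreal (\<integral>w. indicator {w \<in> space P. w \<in> A \<and> Y w \<in> B} w \<partial>P)"
      by (simp add: P.emeasure_eq_measure)
    also have "(\<integral>w. indicator {w \<in> space P. w \<in> A \<and> Y w \<in> B} w \<partial>P) = (\<integral>w\<in>A. indicator B (Y w) \<partial>P)"
      unfolding set_lebesgue_integral_def
      by (intro Bochner_Integration.integral_cong) (auto simp: indicator_def)
    \<comment> \<open>The defining property of conditional expectation, available because
      \<open>A\<close> lies in \<open>F\<close>.\<close>
    also have "\<dots> = (\<integral>w\<in>A. real_cond_exp P F (\<lambda>w. indicator B (Y w)) w \<partial>P)"
      by (rule real_cond_exp_intA[OF ind A])
    also have "ennreal \<dots> = (\<integral>\<^sup>+w. ennreal (indicator A w * real_cond_exp P F (\<lambda>w. indicator B (Y w)) w) \<partial>P)"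
      unfolding set_lebesgue_integral_def real_scaleR_def
    proof (rule nn_integral_eq_integral[symmetric])
      show "integrable P (\<lambda>w. indicator A w * real_cond_exp P F (\<lambda>w. indicator B (Y w)) w)"
        using integrable_mult_indicator[OF AP real_cond_exp_int(1)[OF ind]] by simp
      show "AE w in P. 0 \<le> indicator A w * real_cond_exp P F (\<lambda>w. indicator B (Y w)) w"
        using real_cond_exp_pos[of "\<lambda>w. indicator B (Y w)"] by auto
    qed
    also have "\<dots> = (\<integral>\<^sup>+w. indicator A w * ennreal (measure (K w) B) \<partial>P)"
    proof (rule nn_integral_cong_AE)
      have "AE w in P. real_cond_exp P F (\<lambda>w. indicator B (Y w)) w = measure (K w) B"
        using cd B by (simp add: has_cond_distr_def)
      then show "AE w in P. ennreal (indicator A w * real_cond_exp P F (\<lambda>w. indicator B (Y w)) w)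
          = indicator A w * ennreal (measure (K w) B)"
        by eventually_elim (simp add: indicator_def)
    qed
    also have "\<dots> = (\<integral>\<^sup>+w. indicator A w * (\<integral>\<^sup>+y. k w y * indicator B y \<partial>Q) \<partial>P)"
      by (intro nn_integral_cong) (simp add: K_int)
    also have "\<dots> = (\<integral>\<^sup>+w. indicator A w * (\<integral>\<^sup>+y. k w y * indicator B y \<partial>Q) \<partial>?PF)"
    proof (rule nn_integral_subalgebra2[symmetric, OF sub])
      have "(\<lambda>w. \<integral>\<^sup>+y. k (fst (w, y)) (snd (w, y)) * indicator B y \<partial>Q) \<in> borel_measurable F"
        by (intro Q.borel_measurable_nn_integral) measurable
      then show "(\<lambda>w. indicator A w * (\<integral>\<^sup>+y. k w y * indicator B y \<partial>Q)) \<in> borel_measurable F"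
        using A by simp
    qed
    also have "\<dots> = (\<integral>\<^sup>+w. \<integral>\<^sup>+y. k w y * indicator (A \<times> B) (w, y) \<partial>Q \<partial>?PF)"
    proof (intro nn_integral_cong)
      fix w assume "w \<in> space ?PF"
      show "indicator A w * (\<integral>\<^sup>+y. k w y * indicator B y \<partial>Q) = (\<integral>\<^sup>+y. k w y * indicator (A \<times> B) (w, y) \<partial>Q)"
        by (cases "w \<in> A") (simp_all add: indicator_def)
    qed
    also have "\<dots> = (\<integral>\<^sup>+z. k (fst z) (snd z) * indicator (A \<times> B) z \<partial>(?PF \<Otimes>\<^sub>M Q))"
      using ABPF by (subst Q.nn_integral_fst[symmetric]) simp_all
    also have "\<dots> = emeasure N (A \<times> B)"
      unfolding N_def using ABPF by (simp add: emeasure_density)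
    finally show ?thesis .
  qed
  have "N' = N"
  proof (rule measure_eqI_generator_eq[OF Int_stable_pair_measure_generator[of F borel]])
    show "{a \<times> b |a b. a \<in> sets F \<and> b \<in> sets borel} \<subseteq> Pow (space F \<times> space borel)"
      by (rule pair_measure_closed)
    show "sets N' = sigma_sets (space F \<times> space borel) {a \<times> b |a b. a \<in> sets F \<and> b \<in> sets borel}"
      by (simp add: N'_def sets_pair_measure)
    show "sets N = sigma_sets (space F \<times> space borel) {a \<times> b |a b. a \<in> sets F \<and> b \<in> sets borel}"
      unfolding N_def sets_density sets_eq by (rule sets_pair_measure)
    show "range (\<lambda>_::nat. space F \<times> space borel) \<subseteq> {a \<times> b |a b. a \<in> sets F \<and> b \<in> sets (borel :: real measure)}"
      by blast
    show "emeasure N' (space F \<times> space borel) \<noteq> \<infinity>" for i :: nat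
    proof -
      interpret N': prob_space N'
        unfolding N'_def by (rule P.prob_space_distr[OF YF])
      show ?thesis by simp
    qed
  qed (auto simp: rect)
  then have "(\<integral>\<^sup>+w. f (w, Y w) \<partial>P) = (\<integral>\<^sup>+z. f z \<partial>N)"
    using nn_integral_distr[OF YF, of f, unfolded measurable_distr_eq1, OF f] unfolding N'_def by simp
  also have "\<dots> = (\<integral>\<^sup>+z. k (fst z) (snd z) * f z \<partial>(?PF \<Otimes>\<^sub>M Q))"
    unfolding N_def using f unfolding meas_eq[symmetric] by (intro nn_integral_density) simp_all
  also have "\<dots> = (\<integral>\<^sup>+w. \<integral>\<^sup>+y. k w y * f (w, y) \<partial>Q \<partial>?PF)"
    using f unfolding meas_eq[symmetric] by (subst Q.nn_integral_fst[symmetric]) simp_all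
  also have "\<dots> = (\<integral>\<^sup>+w. \<integral>\<^sup>+y. k w y * f (w, y) \<partial>Q \<partial>P)"
  proof (rule nn_integral_subalgebra2[OF sub])
    have "f \<in> borel_measurable (F \<Otimes>\<^sub>M Q)"
      using f by (simp add: cong: measurable_cong_sets)
    then have "(\<lambda>w. \<integral>\<^sup>+y. k (fst (w, y)) (snd (w, y)) * f (w, y) \<partial>Q) \<in> borel_measurable F"
      by (intro Q.borel_measurable_nn_integral) simp
    then show "(\<lambda>w. \<integral>\<^sup>+y. k w y * f (w, y) \<partial>Q) \<in> borel_measurable F" by simp
  qed
  finally show ?thesis .
qed

subsection \<open>Truncated Gaussian mixtures\<close>

text \<open>Boxes pull back to boxes with the same side lengths in another order. Permutations and
  the sign changes of \<open>lborel_distr_reflect\<close> are the symmetries from which isotropy of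
  radial weights is derived.\<close>

lemma lborel_distr_permute_coordinates:
  fixes \<pi> :: "'a::euclidean_space \<Rightarrow> 'a"
  assumes \<pi>: "bij_betw \<pi> Basis Basis"
  shows "distr lborel borel (\<lambda>x. \<Sum>b\<in>Basis. (x \<bullet> \<pi> b) *\<^sub>R b) = lborel"
proof (rule lborel_eqI[symmetric])
  let ?T = "\<lambda>x::'a. \<Sum>b\<in>Basis. (x \<bullet> \<pi> b) *\<^sub>R b"
  let ?\<sigma> = "inv_into Basis \<pi>"
  let ?T' = "\<lambda>x::'a. \<Sum>b\<in>Basis. (x \<bullet> ?\<sigma> b) *\<^sub>R b"
  have \<sigma>: "bij_betw ?\<sigma> Basis Basis" using \<pi> by (rule bij_betw_inv_into)
  have \<sigma>_B: "?\<sigma> b \<in> Basis" if "b \<in> Basis" for b using \<sigma> that by (auto simp: bij_betw_def)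
  have \<pi>_B: "\<pi> b \<in> Basis" if "b \<in> Basis" for b using \<pi> that by (auto simp: bij_betw_def)
  have \<pi>\<sigma>: "\<pi> (?\<sigma> b) = b" if "b \<in> Basis" for b
    using \<pi> that by (auto simp: bij_betw_def f_inv_into_f)
  have \<sigma>\<pi>: "?\<sigma> (\<pi> b) = b" if "b \<in> Basis" for b
    using \<pi> that by (auto simp: bij_betw_def)
  have [measurable]: "?T \<in> borel_measurable borel" by simp
  fix l u :: 'a assume le: "\<And>b. b \<in> Basis \<Longrightarrow> l \<bullet> b \<le> u \<bullet> b"
  have "?T -` box l u = box (?T' l) (?T' u)"
  proof (intro set_eqI)
    fix x
    have "x \<in> ?T -` box l u \<longleftrightarrow> (\<forall>b\<in>Basis. l \<bullet> b < x \<bullet> \<pi> b \<and> x \<bullet> \<pi> b < u \<bullet> b)"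
      by (auto simp: mem_box)
    also have "\<dots> \<longleftrightarrow> (\<forall>b\<in>Basis. l \<bullet> ?\<sigma> b < x \<bullet> b \<and> x \<bullet> b < u \<bullet> ?\<sigma> b)"
      using \<pi>_B \<sigma>_B \<pi>\<sigma> \<sigma>\<pi> by metis
    also have "\<dots> \<longleftrightarrow> x \<in> box (?T' l) (?T' u)"
      by (auto simp: mem_box)
    finally show "x \<in> ?T -` box l u \<longleftrightarrow> x \<in> box (?T' l) (?T' u)" .
  qed
  then have "emeasure (distr lborel borel ?T) (box l u) = emeasure lborel (box (?T' l) (?T' u))"
    by (simp add: emeasure_distr)
  also have "\<dots> = (\<Prod>b\<in>Basis. (?T' u - ?T' l) \<bullet> b)"
    using le \<sigma>_B by (subst emeasure_lborel_box) auto
  also have "(\<Prod>b\<in>Basis. (?T' u - ?T' l) \<bullet> b) = (\<Prod>b\<in>Basis. (u - l) \<bullet> ?\<sigma> b)"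
    by (intro prod.cong) (auto simp: inner_diff_left)
  also have "\<dots> = (\<Prod>b\<in>Basis. (u - l) \<bullet> b)"
    by (rule prod.reindex_bij_betw[OF \<sigma>])
  finally show "emeasure (distr lborel borel ?T) (box l u) = (\<Prod>b\<in>Basis. (u - l) \<bullet> b)" .
qed simp

lemma lborel_distr_reflect:
  fixes c :: "'a::euclidean_space \<Rightarrow> real"
  assumes c: "\<And>b. b \<in> Basis \<Longrightarrow> \<bar>c b\<bar> = 1"
  shows "distr lborel borel (\<lambda>x. \<Sum>b\<in>Basis. (c b * (x \<bullet> b)) *\<^sub>R b) = lborel"
proof -
  have "c b \<noteq> 0" if "b \<in> Basis" for b using c[OF that] by auto
  then have "(lborel :: 'a measure) = density (distr lborel borel (\<lambda>x. 0 + (\<Sum>b\<in>Basis. (c b * (x \<bullet> b)) *\<^sub>R b)))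
      (\<lambda>_. ennreal (\<Prod>b\<in>Basis. \<bar>c b\<bar>))"
    by (rule lborel_affine_euclidean)
  also have "(\<Prod>b\<in>Basis. \<bar>c b\<bar>) = 1" using c by simp
  finally show ?thesis by (simp add: density_1)
qed

lemma norm_signed_permutation:
  fixes \<pi> :: "'a::euclidean_space \<Rightarrow> 'a"
  assumes \<pi>: "bij_betw \<pi> Basis Basis" and c: "\<And>b. b \<in> Basis \<Longrightarrow> \<bar>c b\<bar> = 1"
  shows "norm (\<Sum>b\<in>Basis. (c b * (x \<bullet> \<pi> b)) *\<^sub>R b) = norm x"
proof -
  have [simp]: "c b * c b = 1" if "b \<in> Basis" for b
    using c[OF that] by (metis abs_mult_self_eq mult_1)
  have "(\<Sum>b\<in>Basis. (c b * (x \<bullet> \<pi> b)) *\<^sub>R b) \<bullet> (\<Sum>b\<in>Basis. (c b * (x \<bullet> \<pi> b)) *\<^sub>R b)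
      = (\<Sum>b\<in>Basis. (x \<bullet> \<pi> b) * (x \<bullet> \<pi> b))"
    by (subst euclidean_inner) (auto intro!: sum.cong simp: mult_ac)
  also have "\<dots> = (\<Sum>b\<in>Basis. (x \<bullet> b) * (x \<bullet> b))"
    by (rule sum.reindex_bij_betw[OF \<pi>])
  also have "\<dots> = x \<bullet> x" by (rule euclidean_inner[symmetric])
  finally show ?thesis by (simp add: norm_eq_sqrt_inner)
qed

section \<open>First and second moments of radial weights\<close>

context
  fixes w :: "real \<Rightarrow> real"
  assumes w [measurable]: "w \<in> borel_measurable borel"
begin

text \<open>Flipping the sign of coordinate \<open>i\<close> preserves Lebesgue measure and the norm
  but negates the integrand.\<close>

lemma radial_integral_cross:
  fixes i j :: "'a::euclidean_space"
  assumes "i \<in> Basis" "j \<in> Basis" "i \<noteq> j"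
  shows "(\<integral>x. (x \<bullet> i) * (x \<bullet> j) * w (norm x) \<partial>lborel) = 0"
proof -
  define c where "c b = (if b = i then - 1 else 1 :: real)" for b
  let ?T = "\<lambda>x::'a. \<Sum>b\<in>Basis. (c b * (x \<bullet> b)) *\<^sub>R b"
  let ?f = "\<lambda>x::'a. (x \<bullet> i) * (x \<bullet> j) * w (norm x)"
  have n: "norm (?T x) = norm x" for x
    using norm_signed_permutation[of "\<lambda>b. b" c x] by (simp add: c_def bij_betw_def)
  have "(\<integral>x. ?f x \<partial>lborel) = (\<integral>x. ?f x \<partial>distr lborel borel ?T)"
    by (subst lborel_distr_reflect) (auto simp: c_def)
  also have "\<dots> = (\<integral>x. ?f (?T x) \<partial>lborel)"
    by (rule integral_distr) auto
  also have "\<dots> = (\<integral>x. - ?f x \<partial>lborel)"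
    unfolding n using assms by (intro Bochner_Integration.integral_cong) (auto simp: c_def)
  finally show ?thesis by simp
qed

lemma radial_integral_linear:
  fixes a :: "'a::euclidean_space"
  shows "(\<integral>x. (x \<bullet> a) * w (norm x) \<partial>lborel) = 0"
proof -
  let ?T = "\<lambda>x::'a. \<Sum>b\<in>Basis. (- 1 * (x \<bullet> b)) *\<^sub>R b"
  let ?f = "\<lambda>x::'a. (x \<bullet> a) * w (norm x)"
  have T: "?T x = - x" for x
    by (simp add: sum_negf euclidean_representation)
  have "(\<integral>x. ?f x \<partial>lborel) = (\<integral>x. ?f x \<partial>distr lborel borel ?T)"
    by (subst lborel_distr_reflect) auto
  also have "\<dots> = (\<integral>x. ?f (?T x) \<partial>lborel)"
    by (rule integral_distr) auto
  also have "\<dots> = (\<integral>x. - ?f x \<partial>lborel)"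
    unfolding T by simp
  finally show ?thesis by simp
qed

lemma radial_integral_square:
  fixes i j :: "'a::euclidean_space"
  assumes "i \<in> Basis" "j \<in> Basis"
  shows "(\<integral>x. (x \<bullet> i)\<^sup>2 * w (norm x) \<partial>lborel) = (\<integral>x. (x \<bullet> j)\<^sup>2 * w (norm x) \<partial>lborel)"
proof -
  define \<pi> where "\<pi> b = (if b = i then j else if b = j then i else b)" for b
  let ?T = "\<lambda>x::'a. \<Sum>b\<in>Basis. (x \<bullet> \<pi> b) *\<^sub>R b"
  let ?f = "\<lambda>x::'a. (x \<bullet> i)\<^sup>2 * w (norm x)"
  have \<pi>: "bij_betw \<pi> Basis Basis"
    by (rule bij_betw_byWitness[where f' = \<pi>]) (use assms in \<open>auto simp: \<pi>_def\<close>)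
  have n: "norm (?T x) = norm x" for x
    using norm_signed_permutation[OF \<pi>, of "\<lambda>_. 1" x] by simp
  have "(\<integral>x. ?f x \<partial>lborel) = (\<integral>x. ?f x \<partial>distr lborel borel ?T)"
    by (subst lborel_distr_permute_coordinates[OF \<pi>]) auto
  also have "\<dots> = (\<integral>x. ?f (?T x) \<partial>lborel)"
    by (rule integral_distr) auto
  also have "\<dots> = (\<integral>x. (x \<bullet> j)\<^sup>2 * w (norm x) \<partial>lborel)"
    unfolding n using assms by (intro Bochner_Integration.integral_cong) (auto simp: \<pi>_def)
  finally show ?thesis .
qed

text \<open>The second moment matrix of a radial weight is a multiple of the identity: mixed moments
  vanish and the diagonal ones agree. Its trace is the integral of \<open>(norm x)\<^sup>2\<close>,
  so the multiple is that integral divided by the dimension.\<close>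

lemma radial_integral_inner_square:
  fixes a :: "'a::euclidean_space"
  assumes int: "\<And>i j :: 'a. i \<in> Basis \<Longrightarrow> j \<in> Basis \<Longrightarrow>
    integrable lborel (\<lambda>x. (x \<bullet> i) * (x \<bullet> j) * w (norm x))"
  shows "(\<integral>x. (x \<bullet> a)\<^sup>2 * w (norm x) \<partial>lborel)
    = (norm a)\<^sup>2 / real DIM('a) * (\<integral>(x::'a). (norm x)\<^sup>2 * w (norm x) \<partial>lborel)"
proof -
  define \<kappa> where "\<kappa> i = (\<integral>(x::'a). (x \<bullet> i)\<^sup>2 * w (norm x) \<partial>lborel)" for i
  obtain k :: 'a where k: "k \<in> Basis" using nonempty_Basis by blast
  have \<kappa>: "\<kappa> i = \<kappa> k" if "i \<in> Basis" for i
    unfolding \<kappa>_def using that k by (rule radial_integral_square)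
  have cross: "(\<integral>x. (x \<bullet> i) * (x \<bullet> j) * w (norm x) \<partial>lborel) = (if i = j then \<kappa> k else 0)"
    if "i \<in> Basis" "j \<in> Basis" for i j :: 'a
    using that radial_integral_cross[OF that] \<kappa>[of i] by (auto simp: \<kappa>_def power2_eq_square)
  have "(\<integral>x. (x \<bullet> a)\<^sup>2 * w (norm x) \<partial>lborel)
      = (\<integral>x. (\<Sum>i\<in>Basis. \<Sum>j\<in>Basis. (a \<bullet> i) * (a \<bullet> j) * ((x \<bullet> i) * (x \<bullet> j) * w (norm x))) \<partial>lborel)"
  proof (rule Bochner_Integration.integral_cong)
    fix x :: 'a
    have "(x \<bullet> a)\<^sup>2 * w (norm x) = (\<Sum>i\<in>Basis. (x \<bullet> i) * (a \<bullet> i)) * (\<Sum>j\<in>Basis. (x \<bullet> j) * (a \<bullet> j)) * w (norm x)"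
      by (simp add: power2_eq_square euclidean_inner[of x a])
    also have "\<dots> = (\<Sum>i\<in>Basis. \<Sum>j\<in>Basis. (x \<bullet> i) * (a \<bullet> i) * ((x \<bullet> j) * (a \<bullet> j))) * w (norm x)"
      by (simp only: sum_product)
    also have "\<dots> = (\<Sum>i\<in>Basis. \<Sum>j\<in>Basis. (a \<bullet> i) * (a \<bullet> j) * ((x \<bullet> i) * (x \<bullet> j) * w (norm x)))"
      unfolding sum_distrib_right by (intro sum.cong refl) (simp add: mult_ac)
    finally show "(x \<bullet> a)\<^sup>2 * w (norm x)
      = (\<Sum>i\<in>Basis. \<Sum>j\<in>Basis. (a \<bullet> i) * (a \<bullet> j) * ((x \<bullet> i) * (x \<bullet> j) * w (norm x)))" .
  qed simp
  also have "\<dots> = (\<Sum>i\<in>Basis. \<integral>x. (\<Sum>j\<in>Basis. (a \<bullet> i) * (a \<bullet> j) * ((x \<bullet> i) * (x \<bullet> j) * w (norm x))) \<partial>lborel)"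
    by (intro Bochner_Integration.integral_sum Bochner_Integration.integrable_sum integrable_mult_right int)
  also have "\<dots> = (\<Sum>i\<in>Basis. \<Sum>j\<in>Basis. \<integral>x. (a \<bullet> i) * (a \<bullet> j) * ((x \<bullet> i) * (x \<bullet> j) * w (norm x)) \<partial>lborel)"
    by (intro sum.cong refl Bochner_Integration.integral_sum integrable_mult_right int)
  also have "\<dots> = (\<Sum>i\<in>Basis. \<Sum>j\<in>Basis. (a \<bullet> i) * (a \<bullet> j) * (\<integral>x. (x \<bullet> i) * (x \<bullet> j) * w (norm x) \<partial>lborel))"
    by simp
  also have "\<dots> = (\<Sum>i\<in>Basis. \<Sum>j\<in>Basis. if i = j then (a \<bullet> i) * (a \<bullet> j) * \<kappa> k else 0)"
    by (intro sum.cong refl) (simp add: cross)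
  also have "\<dots> = (\<Sum>i\<in>Basis. (a \<bullet> i) * (a \<bullet> i)) * \<kappa> k"
    by (simp add: sum.delta sum_distrib_right)
  also have "\<dots> = (norm a)\<^sup>2 * \<kappa> k"
    by (simp only: euclidean_inner[symmetric] power2_norm_eq_inner)
  finally have 1: "(\<integral>x. (x \<bullet> a)\<^sup>2 * w (norm x) \<partial>lborel) = (norm a)\<^sup>2 * \<kappa> k" .
  have "(\<integral>(x::'a). (norm x)\<^sup>2 * w (norm x) \<partial>lborel) = (\<integral>(x::'a). (\<Sum>i\<in>Basis. (x \<bullet> i) * (x \<bullet> i) * w (norm x)) \<partial>lborel)"
    by (simp only: power2_norm_eq_inner sum_distrib_right[symmetric] euclidean_inner[symmetric])
  also have "\<dots> = (\<Sum>i\<in>Basis. (\<integral>(x::'a). (x \<bullet> i) * (x \<bullet> i) * w (norm x) \<partial>lborel))"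
    by (intro Bochner_Integration.integral_sum int)
  also have "\<dots> = real DIM('a) * \<kappa> k"
    by (simp add: cross)
  finally show ?thesis using 1 by simp
qed

end

section \<open>Gaussian weights on balls\<close>

lemma nn_integral_lborel_affine:
  fixes f :: "'a::euclidean_space \<Rightarrow> ennreal"
  assumes f [measurable]: "f \<in> borel_measurable borel" and "s > 0"
  shows "(\<integral>\<^sup>+x. f x \<partial>lborel) = ennreal (s ^ DIM('a)) * (\<integral>\<^sup>+x. f (t + s *\<^sub>R x) \<partial>lborel)"
proof -
  have "(\<integral>\<^sup>+x. f x \<partial>lborel)
      = (\<integral>\<^sup>+x. f x \<partial>density (distr lborel borel (\<lambda>x. t + s *\<^sub>R x)) (\<lambda>_. ennreal (\<bar>s\<bar> ^ DIM('a))))"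
    using lborel_affine[of s t] \<open>s > 0\<close> by simp
  also have "\<dots> = (\<integral>\<^sup>+x. ennreal (\<bar>s\<bar> ^ DIM('a)) * f x \<partial>distr lborel borel (\<lambda>x. t + s *\<^sub>R x))"
    by (intro nn_integral_density) auto
  also have "\<dots> = (\<integral>\<^sup>+x. ennreal (\<bar>s\<bar> ^ DIM('a)) * f (t + s *\<^sub>R x) \<partial>lborel)"
    by (intro nn_integral_distr) auto
  also have "\<dots> = ennreal (s ^ DIM('a)) * (\<integral>\<^sup>+x. f (t + s *\<^sub>R x) \<partial>lborel)"
    using \<open>s > 0\<close> by (subst nn_integral_cmult) auto
  finally show ?thesis .
qed

text \<open>Mass of the unnormalised Gaussian weight on a ball; the \<open>itself\<close> argument
  only fixes the space. Positivity and \<open>gauss_mass_double\<close> are all that is known about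
  its value.\<close>

definition gauss_mass :: "real \<Rightarrow> real \<Rightarrow> 'a::euclidean_space itself \<Rightarrow> real" where
  "gauss_mass lam R _ = (\<integral>(x::'a). indicator (cball 0 R) x * exp (- lam * (norm x)\<^sup>2) \<partial>lborel)"

lemma integrable_continuous_cball:
  fixes h :: "'a::euclidean_space \<Rightarrow> real"
  assumes "continuous_on UNIV h"
  shows "integrable lborel (\<lambda>x. indicator (cball 0 R) x * h x)"
  using borel_integrable_compact[of "cball 0 R :: 'a set" h] continuous_on_subset[OF assms]
  by simp

lemma gauss_mass_pos:
  assumes "R > 0"
  shows "gauss_mass lam R TYPE('a::euclidean_space) > 0"
proof -
  let ?h = "\<lambda>x::'a. indicator (cball 0 R) x * exp (- lam * (norm x)\<^sup>2)"
  have int: "integrable lborel ?h"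
    by (intro integrable_continuous_cball continuous_intros)
  have "gauss_mass lam R TYPE('a) \<noteq> 0"
  proof
    assume "gauss_mass lam R TYPE('a) = 0"
    then have "AE x in lborel. ?h x = 0"
      using integral_nonneg_eq_0_iff_AE[OF int] by (simp add: gauss_mass_def)
    then have "AE x::'a in lborel. x \<notin> ball 0 R"
      by eventually_elim (auto simp: indicator_def split: if_splits)
    then have "emeasure lborel (ball (0::'a) R) = 0"
      by (subst (asm) AE_iff_measurable[OF _ refl]) (auto simp: ball_def)
    then show False
      using content_ball_pos[OF assms, of "0::'a"] by (simp add: measure_def)
  qed
  moreover have "gauss_mass lam R TYPE('a) \<ge> 0"
    unfolding gauss_mass_def by (intro Bochner_Integration.integral_nonneg) auto
  ultimately show ?thesis by simp
qed

text \<open>Substituting \<open>2 *\<^sub>R x\<close> maps the ball of radius \<open>R\<close> to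
  the larger one with Jacobian \<open>2 ^ d\<close>, and it only decreases the Gaussian
  weight.\<close>

lemma gauss_mass_double:
  assumes "lam \<ge> 0"
  shows "(\<integral>\<^sup>+(x::'a::euclidean_space). ennreal (indicator (cball 0 (2 * R)) x * exp (- lam * (norm x)\<^sup>2)) \<partial>lborel)
    \<le> ennreal (2 ^ DIM('a) * gauss_mass lam R TYPE('a))"
proof -
  have "(\<lambda>x::'a. indicator (cball 0 (2 * R)) x * exp (- lam * (norm x)\<^sup>2)) \<in> borel_measurable borel"
    by (intro borel_measurable_times borel_measurable_indicator borel_measurable_continuous_onI continuous_intros) simp
  note meas = measurable_compose[OF this measurable_ennreal]
  have "(\<integral>\<^sup>+(x::'a). ennreal (indicator (cball 0 (2 * R)) x * exp (- lam * (norm x)\<^sup>2)) \<partial>lborel)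
      = ennreal (2 ^ DIM('a)) * (\<integral>\<^sup>+(x::'a). ennreal (indicator (cball 0 (2 * R)) (0 + 2 *\<^sub>R x)
          * exp (- lam * (norm (0 + 2 *\<^sub>R x))\<^sup>2)) \<partial>lborel)"
    by (rule nn_integral_lborel_affine[OF meas]) simp
  also have "\<dots> \<le> ennreal (2 ^ DIM('a)) * (\<integral>\<^sup>+(x::'a). ennreal (indicator (cball 0 R) x * exp (- lam * (norm x)\<^sup>2)) \<partial>lborel)"
    using assms
    by (intro mult_left_mono nn_integral_mono ennreal_leI)
       (auto simp: indicator_def power_mult_distrib intro!: mult_left_mono)
  also have "(\<integral>\<^sup>+(x::'a). ennreal (indicator (cball 0 R) x * exp (- lam * (norm x)\<^sup>2)) \<partial>lborel)
      = ennreal (gauss_mass lam R TYPE('a))"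
    unfolding gauss_mass_def
    by (intro nn_integral_eq_integral integrable_continuous_cball continuous_intros) auto
  also have "ennreal (2 ^ DIM('a)) * ennreal (gauss_mass lam R TYPE('a))
      = ennreal (2 ^ DIM('a) * gauss_mass lam R TYPE('a))"
    by (rule ennreal_mult'[symmetric]) simp
  finally show ?thesis .
qed

text \<open>Substituting \<open>\<xi> = \<xi>0 + s \<zeta>\<close> and applying Jensen's inequality with respect to the weight
  \<open>exp (- lam * (norm \<zeta>)\<^sup>2)\<close> on the ball of radius \<open>R\<close>: by isotropy of that weight the linear
  term averages to 0, and the scale \<open>s\<close> makes the quadratic terms average to something
  non-negative. This replaces the usual determinant computation.\<close>

lemma gauss_mixture_lower_bound:
  fixes z :: "'i \<Rightarrow> 'a::euclidean_space" and S \<xi>0 :: 'a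
  assumes lam: "lam > 0" and \<xi>0: "norm \<xi>0 \<le> R"
    and c: "\<And>i. i \<in> I \<Longrightarrow> c i \<ge> 0" and z: "\<And>i. i \<in> I \<Longrightarrow> norm (z i) \<le> 1"
    and T: "(\<Sum>i\<in>I. c i) \<le> T" "T \<ge> 0"
    and f_def: "f = (\<lambda>\<xi>. \<xi> \<bullet> S - (\<Sum>i\<in>I. c i * (\<xi> \<bullet> z i)\<^sup>2) - lam * (norm \<xi>)\<^sup>2)"
    and s_def: "s = 1 / sqrt (1 + T / (lam * real DIM('a)))"
  shows "ennreal (s ^ DIM('a) * exp (f \<xi>0) * gauss_mass lam R TYPE('a))
    \<le> (\<integral>\<^sup>+\<xi>. ennreal (indicator (cball 0 (2 * R)) \<xi> * exp (f \<xi>)) \<partial>lborel)"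
proof -
  define d where "d = real DIM('a)"
  have d: "d > 0" by (simp add: d_def)
  have pos: "1 + T / (lam * d) \<ge> 1" using lam d T by simp
  have s: "s > 0" "s \<le> 1" using pos by (auto simp: s_def d_def)
  have "s\<^sup>2 = 1 / (1 + T / (lam * d))"
    using pos by (simp add: s_def d_def power_divide)
  moreover have "lam + T / d = lam * (1 + T / (lam * d))"
    using lam by (simp add: field_simps)
  \<comment> \<open>This equation determines \<open>s\<close>: it makes the average of the exponent
    \<open>a\<close> below non-negative whenever the weights \<open>c i\<close> sum to at most
    \<open>T\<close>. By the inequality of arithmetic and geometric means, \<open>s ^ d\<close> is a
    lower bound for the square root of the determinant of \<open>lam\<close> times the identity over
    that of the full quadratic form.\<close>
  ultimately have s2: "s\<^sup>2 * (lam + T / d) = lam"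
    using pos by simp
  define w where "w r = (if r \<le> R then exp (- lam * r\<^sup>2) else 0)" for r :: real
  have w_meas [measurable]: "w \<in> borel_measurable borel" unfolding w_def by measurable
  have w_eq: "w (norm x) = indicator (cball 0 R) x * exp (- lam * (norm x)\<^sup>2)" for x :: 'a
    by (simp add: w_def indicator_def)
  have w_nonneg: "w r \<ge> 0" for r by (simp add: w_def)
  have int: "integrable lborel (\<lambda>x::'a. h x * w (norm x))" if "continuous_on UNIV h" for h
  proof -
    have "integrable lborel (\<lambda>x::'a. indicator (cball 0 R) x * (h x * exp (- lam * (norm x)\<^sup>2)))"
      by (intro integrable_continuous_cball continuous_intros that)
    then show ?thesis by (simp add: w_eq mult_ac)
  qed
  define \<kappa> where "\<kappa> = (\<integral>(x::'a). (norm x)\<^sup>2 * w (norm x) \<partial>lborel)"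
  have \<kappa>: "\<kappa> \<ge> 0" unfolding \<kappa>_def using w_nonneg by simp
  have sq: "(\<integral>(x::'a). (x \<bullet> a)\<^sup>2 * w (norm x) \<partial>lborel) = (norm a)\<^sup>2 / d * \<kappa>" for a
    unfolding \<kappa>_def d_def
    by (rule radial_integral_inner_square[OF w_meas]) (intro int continuous_intros)
  \<comment> \<open>The gradient of \<open>f\<close> at \<open>\<xi>0\<close>. The exponent
    \<open>a\<close> is measured relative to the weight
    \<open>exp (- lam * (norm \<zeta>)\<^sup>2)\<close>, which is why
    \<open>lam * (norm \<zeta>)\<^sup>2\<close> is added back in it.\<close>
  define b where "b = S - (\<Sum>i\<in>I. (2 * c i * (\<xi>0 \<bullet> z i)) *\<^sub>R z i) - (2 * lam) *\<^sub>R \<xi>0"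
  define a where "a \<zeta> = s * (\<zeta> \<bullet> b) + (lam - s\<^sup>2 * lam) * (norm \<zeta>)\<^sup>2
      - s\<^sup>2 * (\<Sum>i\<in>I. c i * (\<zeta> \<bullet> z i)\<^sup>2)" for \<zeta>
  have a_eq: "f (\<xi>0 + s *\<^sub>R \<zeta>) = f \<xi>0 + a \<zeta> - lam * (norm \<zeta>)\<^sup>2" for \<zeta>
  proof -
    have 1: "(\<Sum>i\<in>I. c i * ((\<xi>0 + s *\<^sub>R \<zeta>) \<bullet> z i)\<^sup>2)
        = (\<Sum>i\<in>I. c i * (\<xi>0 \<bullet> z i)\<^sup>2) + s * (\<Sum>i\<in>I. 2 * c i * (\<xi>0 \<bullet> z i) * (\<zeta> \<bullet> z i))
          + s\<^sup>2 * (\<Sum>i\<in>I. c i * (\<zeta> \<bullet> z i)\<^sup>2)"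
      unfolding sum_distrib_left sum.distrib[symmetric]
      by (intro sum.cong refl) (simp add: inner_add_left power2_eq_square algebra_simps)
    have 2: "\<zeta> \<bullet> b = \<zeta> \<bullet> S - (\<Sum>i\<in>I. 2 * c i * (\<xi>0 \<bullet> z i) * (\<zeta> \<bullet> z i)) - 2 * lam * (\<zeta> \<bullet> \<xi>0)"
      by (simp add: b_def inner_diff_right inner_sum_right)
    have 3: "(norm (\<xi>0 + s *\<^sub>R \<zeta>))\<^sup>2 = (norm \<xi>0)\<^sup>2 + 2 * s * (\<zeta> \<bullet> \<xi>0) + s\<^sup>2 * (norm \<zeta>)\<^sup>2"
      unfolding power2_norm_eq_inner
      by (simp add: inner_add_left inner_add_right inner_commute power2_eq_square algebra_simps)
    show ?thesis
      unfolding f_def a_def 1 2 3 by (simp add: inner_add_left algebra_simps)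
  qed
  have int_a: "integrable lborel (\<lambda>\<zeta>. a \<zeta> * w (norm \<zeta>))"
    unfolding a_def by (intro int continuous_intros)
  have "(\<integral>\<zeta>. a \<zeta> * w (norm \<zeta>) \<partial>lborel)
      = (\<integral>\<zeta>. s * ((\<zeta> \<bullet> b) * w (norm \<zeta>)) + (lam - s\<^sup>2 * lam) * ((norm \<zeta>)\<^sup>2 * w (norm \<zeta>))
          - s\<^sup>2 * (\<Sum>i\<in>I. c i * ((\<zeta> \<bullet> z i)\<^sup>2 * w (norm \<zeta>))) \<partial>lborel)"
    unfolding a_def by (intro Bochner_Integration.integral_cong refl)
      (simp add: algebra_simps sum_distrib_left)
  also have "\<dots> = s * (\<integral>\<zeta>. (\<zeta> \<bullet> b) * w (norm \<zeta>) \<partial>lborel) + (lam - s\<^sup>2 * lam) * \<kappa>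
      - s\<^sup>2 * (\<Sum>i\<in>I. c i * (\<integral>\<zeta>. (\<zeta> \<bullet> z i)\<^sup>2 * w (norm \<zeta>) \<partial>lborel))"
    unfolding \<kappa>_def
    by (subst Bochner_Integration.integral_diff Bochner_Integration.integral_add Bochner_Integration.integral_sum
        | intro Bochner_Integration.integrable_diff Bochner_Integration.integrable_add Bochner_Integration.integrable_sum
          integrable_mult_right int continuous_intros | simp)+
  also have "\<dots> = \<kappa> * (lam - s\<^sup>2 * (lam + (\<Sum>i\<in>I. c i * (norm (z i))\<^sup>2) / d))"
    unfolding sq radial_integral_linear[OF w_meas]
    by (simp add: algebra_simps sum_distrib_left sum_divide_distrib)
  also have "\<dots> \<ge> 0"
  proof -
    have "(\<Sum>i\<in>I. c i * (norm (z i))\<^sup>2) \<le> (\<Sum>i\<in>I. c i * 1)"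
      using c z by (intro sum_mono mult_left_mono) (auto simp: power_le_one)
    also have "\<dots> \<le> T" using T by simp
    finally have "s\<^sup>2 * (lam + (\<Sum>i\<in>I. c i * (norm (z i))\<^sup>2) / d) \<le> s\<^sup>2 * (lam + T / d)"
      using d by (intro mult_left_mono add_left_mono divide_right_mono) auto
    then show ?thesis using \<kappa> s2 by simp
  qed
  finally have a_nonneg: "(\<integral>\<zeta>. a \<zeta> * w (norm \<zeta>) \<partial>lborel) \<ge> 0" .
  have int_exp: "integrable lborel (\<lambda>\<zeta>. exp (a \<zeta>) * w (norm \<zeta>))"
    unfolding a_def by (intro int continuous_intros)
  have int_w: "integrable lborel (\<lambda>\<zeta>::'a. w (norm \<zeta>))"
    using int[of "\<lambda>_. 1"] by simp
  \<comment> \<open>Jensen's inequality in the form \<open>1 + a \<le> exp a\<close>, integrated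
    against the unnormalised weight.\<close>
  have "gauss_mass lam R TYPE('a) \<le> (\<integral>\<zeta>. w (norm \<zeta>) + a \<zeta> * w (norm \<zeta>) \<partial>lborel)"
    unfolding gauss_mass_def w_eq[symmetric] using a_nonneg int_w int_a by simp
  also have "\<dots> \<le> (\<integral>\<zeta>. exp (a \<zeta>) * w (norm \<zeta>) \<partial>lborel)"
  proof (rule integral_mono)
    fix \<zeta>
    have "(1 + a \<zeta>) * w (norm \<zeta>) \<le> exp (a \<zeta>) * w (norm \<zeta>)"
      by (intro mult_right_mono w_nonneg exp_ge_add_one_self)
    then show "w (norm \<zeta>) + a \<zeta> * w (norm \<zeta>) \<le> exp (a \<zeta>) * w (norm \<zeta>)"
      by (simp add: algebra_simps)
  qed (auto intro: int_w int_a int_exp)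
  finally have "ennreal (exp (f \<xi>0) * gauss_mass lam R TYPE('a))
      \<le> ennreal (exp (f \<xi>0) * (\<integral>\<zeta>. exp (a \<zeta>) * w (norm \<zeta>) \<partial>lborel))"
    by (intro ennreal_leI mult_left_mono) auto
  also have "\<dots> = ennreal (\<integral>\<zeta>. exp (f \<xi>0) * (exp (a \<zeta>) * w (norm \<zeta>)) \<partial>lborel)"
    by simp
  also have "\<dots> = (\<integral>\<^sup>+\<zeta>. ennreal (exp (f \<xi>0) * (exp (a \<zeta>) * w (norm \<zeta>))) \<partial>lborel)"
    using w_nonneg by (intro nn_integral_eq_integral[symmetric] integrable_mult_right int_exp) auto
  also have "\<dots> \<le> (\<integral>\<^sup>+\<zeta>. ennreal (indicator (cball 0 (2 * R)) (\<xi>0 + s *\<^sub>R \<zeta>) * exp (f (\<xi>0 + s *\<^sub>R \<zeta>))) \<partial>lborel)"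
  proof (intro nn_integral_mono ennreal_leI)
    fix \<zeta> :: 'a
    show "exp (f \<xi>0) * (exp (a \<zeta>) * w (norm \<zeta>))
      \<le> indicator (cball 0 (2 * R)) (\<xi>0 + s *\<^sub>R \<zeta>) * exp (f (\<xi>0 + s *\<^sub>R \<zeta>))"
    proof (cases "norm \<zeta> \<le> R")
      case True
      have "norm (\<xi>0 + s *\<^sub>R \<zeta>) \<le> norm \<xi>0 + s * norm \<zeta>"
        using norm_triangle_ineq[of \<xi>0 "s *\<^sub>R \<zeta>"] s by simp
      also have "\<dots> \<le> R + 1 * R" using \<xi>0 True s by (intro add_mono mult_mono) auto
      finally have "\<xi>0 + s *\<^sub>R \<zeta> \<in> cball 0 (2 * R)" by simp
      then have "indicator (cball 0 (2 * R)) (\<xi>0 + s *\<^sub>R \<zeta>) = (1::real)" by simp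
      then show ?thesis using True by (simp add: a_eq w_def flip: exp_add)
    next
      case False
      then show ?thesis by (simp add: w_def)
    qed
  qed
  finally have le: "ennreal (exp (f \<xi>0) * gauss_mass lam R TYPE('a))
      \<le> (\<integral>\<^sup>+\<zeta>. ennreal (indicator (cball 0 (2 * R)) (\<xi>0 + s *\<^sub>R \<zeta>) * exp (f (\<xi>0 + s *\<^sub>R \<zeta>))) \<partial>lborel)" .
  have "(\<lambda>\<xi>. indicator (cball 0 (2 * R)) \<xi> * exp (f \<xi>)) \<in> borel_measurable borel"
    unfolding f_def
    by (intro borel_measurable_times borel_measurable_indicator borel_measurable_continuous_onI continuous_intros) simp
  note f_meas = measurable_compose[OF this measurable_ennreal]
  have "ennreal (s ^ DIM('a)) * ennreal (exp (f \<xi>0) * gauss_mass lam R TYPE('a))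
      \<le> ennreal (s ^ DIM('a)) * (\<integral>\<^sup>+\<zeta>. ennreal (indicator (cball 0 (2 * R)) (\<xi>0 + s *\<^sub>R \<zeta>) * exp (f (\<xi>0 + s *\<^sub>R \<zeta>))) \<partial>lborel)"
    by (rule mult_left_mono[OF le]) simp
  also have "\<dots> = (\<integral>\<^sup>+\<xi>. ennreal (indicator (cball 0 (2 * R)) \<xi> * exp (f \<xi>)) \<partial>lborel)"
    by (rule nn_integral_lborel_affine[OF f_meas \<open>s > 0\<close>, symmetric])
  finally show ?thesis
    using s by (simp add: ennreal_mult'[symmetric] mult.assoc)
qed

subsection \<open>Score equation and conditional exponential bound\<close>

lemma outer_product_vector_mult:
  fixes x :: "real ^ 'd" and w :: "real ^ 'd"
  shows "((columnvector x :: real ^ 1 ^ 'd) ** rowvector x) *v w = (x \<bullet> w) *\<^sub>R x"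
  by (simp add: vec_eq_iff matrix_vector_mult_def matrix_matrix_mult_def columnvector_def rowvector_def
      inner_vec_def sum_distrib_left sum_distrib_right mult_ac)

lemma sum_matrix_vector_mult:
  fixes A :: "'i \<Rightarrow> real ^ 'n ^ 'm"
  shows "(\<Sum>i\<in>I. A i) *v w = (\<Sum>i\<in>I. A i *v w)"
  by (induction I rule: infinite_finite_induct) (auto simp: matrix_vector_mult_add_rdistrib)

lemma H_vector_mult:
  "H Q lam \<theta>s x t *v w = (\<Sum>i=1..t. (deriv (mu Q) (x i \<bullet> \<theta>s) * (x i \<bullet> w)) *\<^sub>R x i) + lam *\<^sub>R w"
  by (simp add: H_def matrix_vector_mult_add_rdistrib sum_matrix_vector_mult
      scaleR_matrix_vector_assoc[symmetric] outer_product_vector_mult)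

lemma H_quadratic_form:
  "w \<bullet> (H Q lam \<theta>s x t *v w)
    = (\<Sum>i=1..t. deriv (mu Q) (x i \<bullet> \<theta>s) * (w \<bullet> x i)\<^sup>2) + lam * (norm w)\<^sup>2"
  unfolding H_vector_mult power2_norm_eq_inner
  by (simp add: inner_add_right inner_sum_right power2_eq_square inner_commute mult_ac)

lemma borel_measurable_det:
  fixes A :: "'w \<Rightarrow> real ^ 'n ^ 'n"
  assumes "\<And>i j. (\<lambda>w. A w $ i $ j) \<in> borel_measurable P"
  shows "(\<lambda>w. det (A w)) \<in> borel_measurable P"
  unfolding det_def
  by (intro borel_measurable_sum borel_measurable_times borel_measurable_prod borel_measurable_const assms)

context exp_family
begin

text \<open>Jensen's inequality for \<open>exp\<close> under \<open>Q\<close>. The linear lower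
  bound on \<open>psi\<close> makes the regularised likelihood coercive in
  \<open>theta_hat_score\<close>.\<close>

lemma psi_ge_tangent_0: "u * mu Q 0 \<le> psi Q u"
proof -
  define m where "m = (\<integral>y. y \<partial>Q)"
  have "mom 0 0 = 1" by (simp add: mom_def prob_space space_eq_univ[symmetric] del: space_eq_univ)
  then have m: "mu Q 0 = m" by (simp add: mu_eq mom_def m_def)
  have int: "integrable Q (\<lambda>y. y)" using integrable_power_exp[of 1 0] by simp
  have "exp (u * m) = (\<integral>y. exp (u * m) * (1 + (u * y - u * m)) \<partial>Q)"
    using int prob_space by (simp add: m_def)
  also have "\<dots> \<le> (\<integral>y. exp (u * y) \<partial>Q)"
  proof (rule integral_mono)
    fix y
    have "exp (u * m) * (1 + (u * y - u * m)) \<le> exp (u * m) * exp (u * y - u * m)"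
      by (intro mult_left_mono exp_ge_add_one_self) auto
    also have "\<dots> = exp (u * y)" by (simp flip: exp_add)
    finally show "exp (u * m) * (1 + (u * y - u * m)) \<le> exp (u * y)" .
  qed (use int integrable_exp in auto)
  also have "\<dots> = exp (psi Q u)" by (rule exp_psi[symmetric])
  finally show ?thesis by (simp add: m)
qed

lemma continuous_psi: "continuous_on UNIV (psi Q)"
  using DERIV_continuous_on[OF has_field_derivative_at_within[OF psi_deriv]] .

lemma mu_measurable [measurable]: "mu Q \<in> borel_measurable borel"
  by (intro borel_measurable_continuous_onI DERIV_continuous_on[OF has_field_derivative_at_within[OF mu_deriv]])

lemma deriv_mu_measurable [measurable]: "deriv (mu Q) \<in> borel_measurable borel"
  by (intro borel_measurable_continuous_onI DERIV_continuous_on[OF has_field_derivative_at_within[OF deriv_mu_deriv]])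

lemma psi_measurable [measurable]: "psi Q \<in> borel_measurable borel"
  by (intro borel_measurable_continuous_onI continuous_psi)

text \<open>\<open>arg_min\<close> is a choice operator and carries information only once some
  minimiser is known to exist. Hence a compactness argument precedes the first-order
  condition.\<close>

lemma theta_hat_score:
  fixes x :: "nat \<Rightarrow> real ^ 'd"
  assumes lam: "lam > 0"
  shows "g Q lam x t (theta_hat Q lam x y t) = (\<Sum>i=1..t. y i *\<^sub>R x i)"
proof -
  define J where "J \<theta> = lam / 2 * (norm \<theta>)\<^sup>2 - (\<Sum>i=1..t. y i * (x i \<bullet> \<theta>) - psi Q (x i \<bullet> \<theta>))" for \<theta>
  define b where "b = (\<Sum>i=1..t. (y i - mu Q 0) *\<^sub>R x i)"
  \<comment> \<open>Beyond this radius \<open>lam / 2 * (norm \<theta>)\<^sup>2\<close> exceeds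
    \<open>norm b * norm \<theta>\<close>, so the objective is at least its value 0 at the
    origin.\<close>
  define R where "R = 2 * norm b / lam"
  have R: "R \<ge> 0" using lam by (simp add: R_def)
  have cont: "continuous_on UNIV J"
    unfolding J_def
    by (intro continuous_intros continuous_on_compose2[OF continuous_psi]) auto
  have J0: "J 0 = 0" by (simp add: J_def psi_0)
  obtain \<theta>0 where \<theta>0: "\<theta>0 \<in> cball 0 R" "\<And>\<theta>. \<theta> \<in> cball 0 R \<Longrightarrow> J \<theta>0 \<le> J \<theta>"
  proof -
    have "\<exists>\<theta>0\<in>cball 0 R. \<forall>\<theta>\<in>cball 0 R. J \<theta>0 \<le> J \<theta>"
      using R by (intro continuous_attains_inf continuous_on_subset[OF cont]) auto
    then show ?thesis using that by blast
  qed
  have min0: "J \<theta>0 \<le> J \<theta>" for \<theta>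
  proof (cases "norm \<theta> \<le> R")
    case True
    then show ?thesis using \<theta>0(2) by simp
  next
    case False
    have "(\<Sum>i=1..t. y i * (x i \<bullet> \<theta>) - psi Q (x i \<bullet> \<theta>)) \<le> (\<Sum>i=1..t. y i * (x i \<bullet> \<theta>) - (x i \<bullet> \<theta>) * mu Q 0)"
      by (intro sum_mono diff_left_mono psi_ge_tangent_0)
    also have "\<dots> = b \<bullet> \<theta>"
      unfolding b_def inner_sum_left by (intro sum.cong refl) (simp add: algebra_simps)
    also have "\<dots> \<le> norm b * norm \<theta>" by (rule norm_cauchy_schwarz)
    also have "\<dots> = (lam * R / 2) * norm \<theta>" using lam by (simp add: R_def)
    also have "\<dots> \<le> (lam * norm \<theta> / 2) * norm \<theta>"
      using False lam by (intro mult_right_mono divide_right_mono mult_left_mono) auto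
    finally have "J \<theta> \<ge> 0" by (simp add: J_def power2_eq_square)
    moreover have "J \<theta>0 \<le> J 0"
      using R by (intro \<theta>0(2)) simp
    ultimately show ?thesis using J0 by simp
  qed
  define \<theta>h where "\<theta>h = theta_hat Q lam x y t"
  have "is_arg_min J (\<lambda>_. True) \<theta>0"
    using min0 by (simp add: is_arg_min_linorder)
  then have "is_arg_min J (\<lambda>_. True) (arg_min J (\<lambda>_. True))"
    unfolding arg_min_def by (rule someI)
  moreover have "arg_min J (\<lambda>_. True) = \<theta>h"
    unfolding \<theta>h_def theta_hat_def J_def ..
  ultimately have min: "J \<theta>h \<le> J \<theta>" for \<theta>
    by (simp add: is_arg_min_linorder)
  \<comment> \<open>The gradient of \<open>J\<close> at \<open>\<theta>h\<close>. Along its own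
    direction the derivative is \<open>e \<bullet> e\<close>, so a single line through the minimiser
    gives the full stationarity condition.\<close>
  define e where "e = g Q lam x t \<theta>h - (\<Sum>i=1..t. y i *\<^sub>R x i)"
  have "((\<lambda>r. J (\<theta>h + r *\<^sub>R e)) has_real_derivative e \<bullet> e) (at 0)"
  proof -
    have psi: "((\<lambda>r. psi Q (x i \<bullet> \<theta>h + r * (x i \<bullet> e))) has_real_derivative mu Q (x i \<bullet> \<theta>h) * (x i \<bullet> e)) (at 0)" for i
    proof -
      have 1: "(psi Q has_real_derivative mu Q (x i \<bullet> \<theta>h)) (at (x i \<bullet> \<theta>h + 0 * (x i \<bullet> e)))"
        using psi_deriv[of "x i \<bullet> \<theta>h"] by simp
      have 2: "((\<lambda>r. x i \<bullet> \<theta>h + r * (x i \<bullet> e)) has_real_derivative (x i \<bullet> e)) (at 0)"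
        by (auto intro!: derivative_eq_intros)
      show ?thesis by (rule DERIV_chain2[OF 1 2])
    qed
    have J_line: "J (\<theta>h + r *\<^sub>R e) = lam / 2 * (\<theta>h \<bullet> \<theta>h + 2 * r * (\<theta>h \<bullet> e) + r\<^sup>2 * (e \<bullet> e))
        - (\<Sum>i=1..t. y i * (x i \<bullet> \<theta>h + r * (x i \<bullet> e)) - psi Q (x i \<bullet> \<theta>h + r * (x i \<bullet> e)))" for r
      unfolding J_def power2_norm_eq_inner
      by (simp add: inner_add_left inner_add_right inner_commute power2_eq_square algebra_simps)
    have "((\<lambda>r. lam / 2 * (\<theta>h \<bullet> \<theta>h + 2 * r * (\<theta>h \<bullet> e) + r\<^sup>2 * (e \<bullet> e))
        - (\<Sum>i=1..t. y i * (x i \<bullet> \<theta>h + r * (x i \<bullet> e)) - psi Q (x i \<bullet> \<theta>h + r * (x i \<bullet> e))))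
        has_real_derivative (lam * (\<theta>h \<bullet> e) - (\<Sum>i=1..t. y i * (x i \<bullet> e) - mu Q (x i \<bullet> \<theta>h) * (x i \<bullet> e)))) (at 0)"
      by (auto intro!: derivative_eq_intros psi sum.cong simp: mult.commute)
    moreover have "lam * (\<theta>h \<bullet> e) - (\<Sum>i=1..t. y i * (x i \<bullet> e) - mu Q (x i \<bullet> \<theta>h) * (x i \<bullet> e)) = e \<bullet> e"
    proof -
      have "e \<bullet> e = (g Q lam x t \<theta>h - (\<Sum>i=1..t. y i *\<^sub>R x i)) \<bullet> e" by (simp only: e_def[symmetric])
      then show ?thesis
        by (simp add: g_def inner_diff_left inner_add_left inner_sum_left sum_subtractf)
    qed
    ultimately show ?thesis by (simp only: J_line)
  qed
  then have "e \<bullet> e = 0"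
    by (rule DERIV_local_min[where d = 1]) (auto simp: min)
  then show ?thesis by (simp add: e_def \<theta>h_def)
qed

lemma prob_space_tilted: "prob_space (tilted Q u)"
proof
  have "emeasure (tilted Q u) (space (tilted Q u)) = (\<integral>\<^sup>+y. ennreal (exp (y * u - psi Q u)) \<partial>Q)"
    by (simp add: tilted_def emeasure_density)
  also have "\<dots> = (\<integral>\<^sup>+y. ennreal (exp (- psi Q u)) * ennreal (exp (u * y)) \<partial>Q)"
    by (intro nn_integral_cong) (simp add: mult.commute flip: ennreal_mult exp_add)
  also have "\<dots> = ennreal (exp (- psi Q u)) * ennreal (exp (psi Q u))"
    by (subst nn_integral_cmult) (simp_all add: nn_integral_exp)
  also have "\<dots> = 1"
    by (simp flip: ennreal_mult exp_add)
  finally show "emeasure (tilted Q u) (space (tilted Q u)) = 1" .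
qed

text \<open>Multiplying the density of \<open>tilted Q u\<close> by \<open>exp (s * y)\<close>
  shifts its parameter to \<open>u + s\<close>, so the inner integral is the exponential of the gap
  in \<open>psi_bernstein\<close>, at most 1. The factor \<open>h\<close> carries the past: the
  inequality for all such \<open>h\<close> replaces a bound on a conditional expectation.\<close>

lemma conditional_exponential_bound:
  fixes x :: "'w \<Rightarrow> real ^ 'd"
  assumes P: "prob_space P" and sub: "subalgebra P F" and x [measurable]: "x \<in> borel_measurable F"
    and cd: "has_cond_distr P F Y (\<lambda>w. tilted Q (x w \<bullet> \<theta>s))"
    and h [measurable]: "h \<in> borel_measurable F"
    and sc: "\<And>u. \<bar>deriv (deriv (mu Q)) u\<bar> \<le> M * deriv (mu Q) u" and "M > 0"
    and \<xi>: "\<And>w. w \<in> space P \<Longrightarrow> M * \<bar>\<xi> \<bullet> x w\<bar> \<le> 1"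
  shows "(\<integral>\<^sup>+w. h w * ennreal (exp ((\<xi> \<bullet> x w) * (Y w - mu Q (x w \<bullet> \<theta>s))
      - deriv (mu Q) (x w \<bullet> \<theta>s) * (\<xi> \<bullet> x w)\<^sup>2)) \<partial>P) \<le> (\<integral>\<^sup>+w. h w \<partial>P)"
proof -
  define u where "u w = x w \<bullet> \<theta>s" for w
  define s where "s w = \<xi> \<bullet> x w" for w
  have [measurable]: "u \<in> borel_measurable F" "s \<in> borel_measurable F"
    unfolding u_def s_def by measurable
  define f where "f = (\<lambda>(w, y). h w * ennreal (exp (s w * (y - mu Q (u w)) - deriv (mu Q) (u w) * (s w)\<^sup>2)))"
  have f: "f \<in> borel_measurable (F \<Otimes>\<^sub>M borel)"
    unfolding f_def by measurable
  have "(\<integral>\<^sup>+w. f (w, Y w) \<partial>P) = (\<integral>\<^sup>+w. (\<integral>\<^sup>+y. ennreal (exp (y * u w - psi Q (u w))) * f (w, y) \<partial>Q) \<partial>P)"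
  proof (rule has_cond_distr_density[OF P sub _ _ _ _ _ cd f])
    show "sigma_finite_measure Q" by unfold_locales
    show "(\<lambda>(w, y). ennreal (exp (y * u w - psi Q (u w)))) \<in> borel_measurable (F \<Otimes>\<^sub>M borel)"
      by measurable
  qed (auto simp: tilted_def[symmetric] u_def prob_space_tilted)
  also have "\<dots> \<le> (\<integral>\<^sup>+w. h w \<partial>P)"
  proof (rule nn_integral_mono)
    fix w assume w: "w \<in> space P"
    \<comment> \<open>The part of the exponent independent of \<open>y\<close>.\<close>
    define c where "c = - psi Q (u w) - s w * mu Q (u w) - deriv (mu Q) (u w) * (s w)\<^sup>2"
    have "(\<integral>\<^sup>+y. ennreal (exp (y * u w - psi Q (u w))) * f (w, y) \<partial>Q)
        = (\<integral>\<^sup>+y. (h w * ennreal (exp c)) * ennreal (exp ((u w + s w) * y)) \<partial>Q)"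
    proof (rule nn_integral_cong)
      fix y
      have "exp (y * u w - psi Q (u w)) * exp (s w * (y - mu Q (u w)) - deriv (mu Q) (u w) * (s w)\<^sup>2)
          = exp c * exp ((u w + s w) * y)"
        unfolding exp_add[symmetric] c_def by (simp add: algebra_simps)
      from arg_cong[OF this, of ennreal]
      show "ennreal (exp (y * u w - psi Q (u w))) * f (w, y)
          = (h w * ennreal (exp c)) * ennreal (exp ((u w + s w) * y))"
        by (simp add: f_def ennreal_mult mult_ac)
    qed
    also have "\<dots> = (h w * ennreal (exp c)) * ennreal (exp (psi Q (u w + s w)))"
      by (subst nn_integral_cmult) (simp_all add: nn_integral_exp)
    also have "\<dots> = h w * ennreal (exp (c + psi Q (u w + s w)))"
      by (simp add: exp_add ennreal_mult mult.assoc)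
    also have "\<dots> \<le> h w * 1"
    proof (rule mult_left_mono)
      have "c + psi Q (u w + s w) \<le> 0"
        using psi_bernstein[OF sc \<open>M > 0\<close>, of "s w" "u w"] \<xi>[OF w] by (simp add: c_def s_def)
      then show "ennreal (exp (c + psi Q (u w + s w))) \<le> 1" by simp
    qed simp
    finally show "(\<integral>\<^sup>+y. ennreal (exp (y * u w - psi Q (u w))) * f (w, y) \<partial>Q) \<le> h w" by simp
  qed
  finally show ?thesis by (simp add: f_def s_def u_def)
qed

end

subsection \<open>The mixture supermartingale\<close>

locale glm_bandit = exp_family Q + P: prob_space P
  for Q :: "real measure" and P :: "'w measure" +
  fixes F :: "nat \<Rightarrow> 'w measure" and \<X> :: "(real ^ 'd) set" and \<theta>s :: "real ^ 'd"
    and X :: "nat \<Rightarrow> 'w \<Rightarrow> real ^ 'd" and Y :: "nat \<Rightarrow> 'w \<Rightarrow> real" and L M lam :: real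
  assumes L: "\<And>u. deriv (mu Q) u \<le> L" "L > 0"
    and sc: "\<And>u. \<bar>deriv (deriv (mu Q)) u\<bar> \<le> M * deriv (mu Q) u" and M: "M > 0"
    and arms: "\<X> \<subseteq> {x. norm x \<le> 1}"
    and si: "sequential_interaction P F Q \<X> \<theta>s X Y"
    and lam: "lam > 0"
begin

text \<open>Half of the radius \<open>1 / M\<close> on which the Bernstein bound holds. The mixture
  fills the ball of radius \<open>2 * rad\<close>, so a ball of radius \<open>rad\<close> about any
  point of norm at most \<open>rad\<close> still lies inside it.\<close>

definition rad :: real where
  "rad = 1 / (2 * M)"

definition score :: "nat \<Rightarrow> 'w \<Rightarrow> real ^ 'd" where
  "score t w = (\<Sum>i=1..t. (Y i w - mu Q (X i w \<bullet> \<theta>s)) *\<^sub>R X i w)"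

definition info :: "nat \<Rightarrow> 'w \<Rightarrow> real ^ 'd \<Rightarrow> real" where
  "info t w \<xi> = (\<Sum>i=1..t. deriv (mu Q) (X i w \<bullet> \<theta>s) * (\<xi> \<bullet> X i w)\<^sup>2)"

text \<open>The last term does not depend on \<open>t\<close>: it is the logarithm of the mixing
  weight, included so that all quadratic terms together form
  \<open>\<xi> \<bullet> (H *v \<xi>)\<close>.\<close>

definition log_mart :: "nat \<Rightarrow> 'w \<Rightarrow> real ^ 'd \<Rightarrow> real" where
  "log_mart t w \<xi> = \<xi> \<bullet> score t w - info t w \<xi> - lam * (norm \<xi>)\<^sup>2"

definition mixture :: "nat \<Rightarrow> 'w \<Rightarrow> ennreal" where
  "mixture t w = (\<integral>\<^sup>+\<xi>. ennreal (indicator (cball 0 (2 * rad)) \<xi> * exp (log_mart t w \<xi>)) \<partial>lborel)"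

lemma subalg: "subalgebra P (F t)"
  using si by (simp add: sequential_interaction_def)

lemma sets_F_mono: "m \<le> n \<Longrightarrow> sets (F m) \<subseteq> sets (F n)"
  using si by (simp add: sequential_interaction_def filtration_def)

lemma space_F: "space (F t) = space P"
  using subalg[of t] by (simp add: subalgebra_def)

lemma measurable_F_mono: "m \<le> n \<Longrightarrow> f \<in> borel_measurable (F m) \<Longrightarrow> f \<in> borel_measurable (F n)"
  using sets_F_mono[of m n] by (auto simp: measurable_def space_F)

lemma X_measurable: "1 \<le> i \<Longrightarrow> i \<le> t \<Longrightarrow> X i \<in> borel_measurable (F t)"
  using si measurable_F_mono[of i t "X i"] by (simp add: sequential_interaction_def measurable_F_mono)

lemma Y_measurable: "1 \<le> i \<Longrightarrow> i < t \<Longrightarrow> Y i \<in> borel_measurable (F t)"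
  using si measurable_F_mono[of "Suc i" t "Y i"] by (simp add: sequential_interaction_def Suc_le_eq)

lemma norm_X: "1 \<le> i \<Longrightarrow> w \<in> space P \<Longrightarrow> norm (X i w) \<le> 1"
  using si arms unfolding sequential_interaction_def by blast

lemma deriv_mu_nonneg: "deriv (mu Q) u \<ge> 0"
  using order.trans[OF abs_ge_zero sc, of u] M by (simp add: zero_le_mult_iff)

text \<open>\<open>F t\<close> describes the state before \<open>Y t\<close> is revealed, so
  quantities that use round \<open>t\<close> are adapted only to \<open>F (Suc t)\<close>. Ville's
  inequality is accordingly applied to the shifted filtration.\<close>

lemma score_measurable: "score t \<in> borel_measurable (F (Suc t))"
proof -
  have "(\<lambda>w. (Y i w - mu Q (X i w \<bullet> \<theta>s)) *\<^sub>R X i w) \<in> borel_measurable (F (Suc t))" if "i \<in> {1..t}" for i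
  proof -
    have [measurable]: "X i \<in> borel_measurable (F (Suc t))" "Y i \<in> borel_measurable (F (Suc t))"
      using that by (auto intro: X_measurable Y_measurable)
    show ?thesis by measurable
  qed
  then show ?thesis
    unfolding score_def[abs_def] by (intro borel_measurable_sum)
qed

lemma log_mart_measurable: "(\<lambda>(w, \<xi>). log_mart t w \<xi>) \<in> borel_measurable (F (Suc t) \<Otimes>\<^sub>M borel)"
proof -
  have "(\<lambda>z. deriv (mu Q) (X i (fst z) \<bullet> \<theta>s) * (snd z \<bullet> X i (fst z))\<^sup>2)
      \<in> borel_measurable (F (Suc t) \<Otimes>\<^sub>M borel)" if "i \<in> {1..t}" for i
  proof -
    have [measurable]: "X i \<in> borel_measurable (F (Suc t))"
      using that by (auto intro: X_measurable)
    show ?thesis by measurable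
  qed
  then have [measurable]: "(\<lambda>z. info t (fst z) (snd z)) \<in> borel_measurable (F (Suc t) \<Otimes>\<^sub>M borel)"
    unfolding info_def by (intro borel_measurable_sum)
  note score_measurable [measurable]
  show ?thesis
    unfolding log_mart_def case_prod_beta' by measurable
qed

lemma mixture_integrand_measurable:
  "(\<lambda>(w, \<xi>). ennreal (indicator (cball 0 (2 * rad)) \<xi> * exp (log_mart t w \<xi>)))
    \<in> borel_measurable (F (Suc t) \<Otimes>\<^sub>M lborel)"
proof -
  have [measurable]: "(\<lambda>z. log_mart t (fst z) (snd z)) \<in> borel_measurable (F (Suc t) \<Otimes>\<^sub>M lborel)"
    using log_mart_measurable[of t] by (simp add: case_prod_beta' cong: measurable_cong_sets)
  have "indicator (cball 0 (2 * rad)) \<in> borel_measurable (borel :: (real ^ 'd) measure)"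
    by (intro borel_measurable_indicator) simp
  from measurable_compose[OF measurable_snd this, of "F (Suc t)"]
  have [measurable]: "(\<lambda>z. indicator (cball 0 (2 * rad)) (snd z) :: real)
      \<in> borel_measurable (F (Suc t) \<Otimes>\<^sub>M (lborel :: (real ^ 'd) measure))"
    by (simp cong: measurable_cong_sets)
  show ?thesis unfolding case_prod_beta' by measurable
qed

lemma mixture_measurable: "mixture t \<in> borel_measurable (F (Suc t))"
  unfolding mixture_def[abs_def]
  using lborel.borel_measurable_nn_integral[OF mixture_integrand_measurable[of t, unfolded case_prod_eta]]
  by simp

text \<open>Tonelli reduces the claim to a fixed \<xi>. Inside the ball, all factors up to round
  \<open>t\<close> go into the past factor \<open>h\<close>, and the increment of
  \<open>log_mart\<close> is the exponent of \<open>conditional_exponential_bound\<close>; outside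
  the ball both sides vanish.\<close>

lemma mixture_supermartingale:
  assumes B: "B \<in> sets (F (Suc t))"
  shows "(\<integral>\<^sup>+w. indicator B w * mixture (Suc t) w \<partial>P) \<le> (\<integral>\<^sup>+w. indicator B w * mixture t w \<partial>P)"
proof -
  let ?I = "indicator (cball 0 (2 * rad)) :: real ^ 'd \<Rightarrow> real"
  interpret PL: pair_sigma_finite P "lborel :: (real ^ 'd) measure" ..
  have BP [measurable]: "B \<in> sets P" using B subalg[of "Suc t"] by (auto simp: subalgebra_def)
  have id: "(\<lambda>w. w) \<in> P \<rightarrow>\<^sub>M F n" for n
    using subalg[of n] by (auto simp: subalgebra_def measurable_def)
  have meas [measurable]: "(\<lambda>z. ennreal (?I (snd z) * exp (log_mart n (fst z) (snd z))))
      \<in> borel_measurable (P \<Otimes>\<^sub>M lborel)" for n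
  proof -
    have "(\<lambda>z. (fst z, snd z)) \<in> P \<Otimes>\<^sub>M lborel \<rightarrow>\<^sub>M F (Suc n) \<Otimes>\<^sub>M (lborel :: (real ^ 'd) measure)"
      by (intro measurable_Pair measurable_compose[OF measurable_fst id] measurable_snd)
    from measurable_compose[OF this mixture_integrand_measurable[of n]]
    show ?thesis by (simp add: case_prod_beta')
  qed
  have sec: "(\<lambda>\<xi>. ennreal (?I \<xi> * exp (log_mart n w \<xi>))) \<in> borel_measurable lborel" if "w \<in> space P" for n w
    using measurable_compose[OF measurable_Pair1'[OF that] meas[of n]] by simp
  have swap: "(\<integral>\<^sup>+w. indicator B w * mixture n w \<partial>P)
      = (\<integral>\<^sup>+\<xi>. (\<integral>\<^sup>+w. indicator B w * ennreal (?I \<xi> * exp (log_mart n w \<xi>)) \<partial>P) \<partial>lborel)" for n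
  proof -
    have "(\<integral>\<^sup>+w. indicator B w * mixture n w \<partial>P)
        = (\<integral>\<^sup>+w. (\<integral>\<^sup>+\<xi>. indicator B w * ennreal (?I \<xi> * exp (log_mart n w \<xi>)) \<partial>lborel) \<partial>P)"
      unfolding mixture_def by (intro nn_integral_cong nn_integral_cmult[symmetric] sec)
    also have "\<dots> = (\<integral>\<^sup>+\<xi>. (\<integral>\<^sup>+w. indicator B w * ennreal (?I \<xi> * exp (log_mart n w \<xi>)) \<partial>P) \<partial>lborel)"
      by (rule PL.Fubini'[symmetric]) (unfold case_prod_beta', measurable)
    finally show ?thesis .
  qed
  have "(\<integral>\<^sup>+w. indicator B w * ennreal (?I \<xi> * exp (log_mart (Suc t) w \<xi>)) \<partial>P)
      \<le> (\<integral>\<^sup>+w. indicator B w * ennreal (?I \<xi> * exp (log_mart t w \<xi>)) \<partial>P)" for \<xi>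
  proof (cases "norm \<xi> \<le> 2 * rad")
    case True
    define h where "h w = indicator B w * ennreal (?I \<xi> * exp (log_mart t w \<xi>))" for w
    have "(\<lambda>w. ennreal (?I \<xi> * exp (log_mart t w \<xi>))) \<in> borel_measurable (F (Suc t))"
      using measurable_compose[OF measurable_Pair2'[of \<xi> lborel "F (Suc t)"] mixture_integrand_measurable[of t]]
      by simp
    then have h: "h \<in> borel_measurable (F (Suc t))"
      unfolding h_def using B by (intro borel_measurable_times_ennreal borel_measurable_indicator)
    have split: "log_mart (Suc t) w \<xi> = log_mart t w \<xi>
        + ((\<xi> \<bullet> X (Suc t) w) * (Y (Suc t) w - mu Q (X (Suc t) w \<bullet> \<theta>s))
          - deriv (mu Q) (X (Suc t) w \<bullet> \<theta>s) * (\<xi> \<bullet> X (Suc t) w)\<^sup>2)" for w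
      by (simp add: log_mart_def score_def info_def inner_add_right mult.commute)
    have "(\<integral>\<^sup>+w. indicator B w * ennreal (?I \<xi> * exp (log_mart (Suc t) w \<xi>)) \<partial>P)
        = (\<integral>\<^sup>+w. h w * ennreal (exp ((\<xi> \<bullet> X (Suc t) w) * (Y (Suc t) w - mu Q (X (Suc t) w \<bullet> \<theta>s))
          - deriv (mu Q) (X (Suc t) w \<bullet> \<theta>s) * (\<xi> \<bullet> X (Suc t) w)\<^sup>2)) \<partial>P)"
      unfolding split h_def exp_add by (intro nn_integral_cong) (simp add: ennreal_mult mult.assoc)
    also have "\<dots> \<le> (\<integral>\<^sup>+w. h w \<partial>P)"
    proof (rule conditional_exponential_bound[OF P.prob_space_axioms subalg _ _ h sc M])
      show "X (Suc t) \<in> borel_measurable (F (Suc t))" by (rule X_measurable) auto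
      show "has_cond_distr P (F (Suc t)) (Y (Suc t)) (\<lambda>w. tilted Q (X (Suc t) w \<bullet> \<theta>s))"
        using si by (simp add: sequential_interaction_def)
      fix w assume w: "w \<in> space P"
      have "\<bar>\<xi> \<bullet> X (Suc t) w\<bar> \<le> norm \<xi> * norm (X (Suc t) w)" by (rule Cauchy_Schwarz_ineq2)
      also have "\<dots> \<le> norm \<xi> * 1" using norm_X[OF _ w] by (intro mult_left_mono) auto
      also have "\<dots> \<le> 1 / M" using True by (simp add: rad_def)
      finally show "M * \<bar>\<xi> \<bullet> X (Suc t) w\<bar> \<le> 1" using M by (simp add: field_simps)
    qed
    finally show ?thesis by (simp add: h_def)
  next
    case False
    then have "?I \<xi> = 0" by simp
    then show ?thesis by simp
  qed
  then show ?thesis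
    unfolding swap by (rule nn_integral_mono)
qed

text \<open>Turns a bound on a linear minus a quadratic form over a Euclidean ball into a dual norm
  bound, by testing one vector in the direction of \<open>matrix_inv H *v v\<close>.\<close>

lemma wnorm_inverse_H_bound:
  fixes x :: "nat \<Rightarrow> real ^ 'd" and v :: "real ^ 'd"
  assumes bound: "\<And>\<xi>. norm \<xi> \<le> R \<Longrightarrow>
      \<xi> \<bullet> v - \<xi> \<bullet> (H Q lam \<theta>s x t *v \<xi>) \<le> K" and R: "R > 0" and K: "0 \<le> K + lam * R\<^sup>2"
  shows "invertible (H Q lam \<theta>s x t)"
    and "wnorm (matrix_inv (H Q lam \<theta>s x t)) v \<le> (K + lam * R\<^sup>2) / (sqrt lam * R)"
proof -
  let ?H = "H Q lam \<theta>s x t"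
  have pos: "lam * (norm w)\<^sup>2 \<le> w \<bullet> (?H *v w)" for w
    unfolding H_quadratic_form using deriv_mu_nonneg by (simp add: sum_nonneg)
  have "w = 0" if "?H *v w = 0" for w
    using pos[of w] that lam by (simp add: mult_le_0_iff)
  then show inv: "invertible ?H"
    unfolding invertible_left_inverse matrix_left_invertible_ker by blast
  define w where "w = matrix_inv ?H *v v"
  have Hw: "?H *v w = v"
    unfolding w_def matrix_vector_mul_assoc
    using someI_ex[OF inv[unfolded invertible_def]] by (simp add: matrix_inv_def)
  define n where "n = wnorm (matrix_inv ?H) v"
  have vw_nonneg: "v \<bullet> w \<ge> 0"
  proof -
    have "0 \<le> lam * (norm w)\<^sup>2" using lam by simp
    then show ?thesis using pos[of w] unfolding Hw inner_commute[of v] by linarith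
  qed
  have n2: "n\<^sup>2 = v \<bullet> w" and n: "n \<ge> 0"
    using vw_nonneg by (auto simp: n_def wnorm_def w_def)
  show "wnorm (matrix_inv ?H) v \<le> (K + lam * R\<^sup>2) / (sqrt lam * R)"
  proof (cases "n = 0")
    case True
    then show ?thesis using K R lam by (simp add: n_def)
  next
    case False
    with n have n_pos: "n > 0" by simp
    \<comment> \<open>Since \<open>w\<close> has \<open>H\<close>-norm \<open>n\<close>, this vector
      has \<open>H\<close>-norm \<open>sqrt lam * R\<close>. Hence its Euclidean norm is at most
      \<open>R\<close>, its quadratic term is \<open>lam * R\<^sup>2\<close>, and its inner product
      with \<open>v\<close> is \<open>sqrt lam * R * n\<close>.\<close>
    define \<xi> where "\<xi> = (sqrt lam * R / n) *\<^sub>R w"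
    have "(sqrt lam * norm w)\<^sup>2 \<le> n\<^sup>2"
      using pos[of w] lam by (simp add: Hw n2 inner_commute power_mult_distrib)
    then have "sqrt lam * norm w \<le> n" using n by (rule power2_le_imp_le)
    then have "norm \<xi> \<le> R"
      using n_pos R lam by (simp add: \<xi>_def field_simps)
    then have "\<xi> \<bullet> v - \<xi> \<bullet> (?H *v \<xi>) \<le> K" by (rule bound)
    moreover have "\<xi> \<bullet> v = sqrt lam * R * n"
      using n_pos by (simp add: \<xi>_def inner_commute n2[symmetric] power2_eq_square)
    moreover have "\<xi> \<bullet> (?H *v \<xi>) = lam * R\<^sup>2"
    proof -
      have "\<xi> \<bullet> (?H *v \<xi>) = (sqrt lam * R / n)\<^sup>2 * (w \<bullet> v)"
        by (simp add: \<xi>_def matrix_vector_mult_scaleR Hw power2_eq_square)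
      then show ?thesis
        using n_pos lam by (simp add: inner_commute n2[symmetric] power_mult_distrib power_divide)
    qed
    ultimately have "n * (sqrt lam * R) \<le> K + lam * R\<^sup>2" by (simp add: mult_ac)
    then show ?thesis
      using R lam by (simp add: n_def pos_le_divide_eq)
  qed
qed

end

subsection \<open>The confidence event\<close>

context glm_bandit
begin

text \<open>The threshold is the upper bound on \<open>mixture 0\<close> from
  \<open>gauss_mass_double\<close>, divided by \<open>del\<close>; this also accounts for the mixing
  weight being unnormalised.\<close>

lemma mixture_deviation:
  assumes del: "del > 0"
  defines "c \<equiv> 2 ^ CARD('d) * gauss_mass lam rad TYPE(real ^ 'd) / del"
  shows "measure P {w \<in> space P. \<exists>n. ennreal c < mixture n w} \<le> del"
proof -
  let ?N = "2 ^ CARD('d) * gauss_mass lam rad TYPE(real ^ 'd)"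
  let ?A = "{w \<in> space P. \<exists>n. ennreal c < mixture n w}"
  have "rad > 0" using M by (simp add: rad_def)
  then have N: "?N > 0" by (simp add: gauss_mass_pos)
  then have c: "c > 0" using del by (simp add: c_def)
  have "ennreal c * emeasure P ?A \<le> (\<integral>\<^sup>+w. mixture 0 w \<partial>P)"
    by (rule ville_inequality[where F = "\<lambda>n. F (Suc n)"])
       (auto intro: subalg mixture_measurable mixture_supermartingale sets_F_mono[THEN subsetD])
  also have "\<dots> \<le> (\<integral>\<^sup>+w. ennreal ?N \<partial>P)"
  proof (rule nn_integral_mono)
    fix w
    show "mixture 0 w \<le> ennreal ?N"
      using gauss_mass_double[of lam rad, where 'a = "real ^ 'd"] lam
      by (simp add: mixture_def log_mart_def score_def info_def)
  qed
  also have "\<dots> = ennreal ?N" by (simp add: P.emeasure_space_1)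
  finally have "ennreal (c * measure P ?A) \<le> ennreal ?N"
    using c by (simp add: P.emeasure_eq_measure ennreal_mult')
  then have "c * measure P ?A \<le> ?N" using N by (simp add: ennreal_le_iff)
  also have "?N = c * del" using del by (simp add: c_def)
  finally show ?thesis using c by simp
qed

text \<open>The assumed upper bound on the mixture meets the lower bound of
  \<open>gauss_mixture_lower_bound\<close>. The Gaussian mass cancels; \<open>2 ^ d\<close> yields
  \<open>d * ln 2\<close>, and \<open>s ^ d\<close> yields the logarithm of
  \<open>q\<close>.\<close>

lemma log_mart_bound:
  assumes w: "w \<in> space P" and del: "del > 0"
    and le: "mixture t w \<le> ennreal (2 ^ CARD('d) * gauss_mass lam rad TYPE(real ^ 'd) / del)"
    and \<xi>: "norm \<xi> \<le> rad"
  shows "log_mart t w \<xi> \<le> real CARD('d) * (ln 2 + 1 / 2 * ln (1 + real t * L / (lam * real CARD('d)))) + ln (1 / del)"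
proof -
  define G where "G = gauss_mass lam rad TYPE(real ^ 'd)"
  define d where "d = CARD('d)"
  define q where "q = 1 + real t * L / (lam * real d)"
  define s where "s = 1 / sqrt q"
  have "rad > 0" using M by (simp add: rad_def)
  then have G: "G > 0" unfolding G_def by (rule gauss_mass_pos)
  have q: "q \<ge> 1" using L lam by (simp add: q_def)
  then have s: "s > 0" by (simp add: s_def)
  have T: "(\<Sum>i=1..t. deriv (mu Q) (X i w \<bullet> \<theta>s)) \<le> real t * L"
    using sum_bounded_above[of "{1..t}" "\<lambda>i. deriv (mu Q) (X i w \<bullet> \<theta>s)" L] L by simp
  have "ennreal (s ^ DIM(real ^ 'd) * exp (log_mart t w \<xi>) * gauss_mass lam rad TYPE(real ^ 'd)) \<le> mixture t w"
    unfolding mixture_def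
  proof (rule gauss_mixture_lower_bound[OF lam \<xi> _ _ T])
    show "log_mart t w = (\<lambda>\<xi>. \<xi> \<bullet> score t w
        - (\<Sum>i=1..t. deriv (mu Q) (X i w \<bullet> \<theta>s) * (\<xi> \<bullet> X i w)\<^sup>2) - lam * (norm \<xi>)\<^sup>2)"
      by (simp add: fun_eq_iff log_mart_def info_def)
  qed (use L w in \<open>auto simp: deriv_mu_nonneg norm_X s_def q_def d_def\<close>)
  also note le
  finally have "ennreal (s ^ d * exp (log_mart t w \<xi>) * G) \<le> ennreal (2 ^ d * G / del)"
    by (simp add: G_def d_def)
  then have "s ^ d * exp (log_mart t w \<xi>) * G \<le> 2 ^ d / del * G"
    using G del by (simp add: ennreal_le_iff)
  then have "s ^ d * exp (log_mart t w \<xi>) \<le> 2 ^ d / del"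
    using G by (simp only: mult_le_cancel_right_pos)
  then have "exp (log_mart t w \<xi>) \<le> 2 ^ d * (1 / del) / s ^ d"
    using s by (subst pos_le_divide_eq) (simp_all add: mult.commute)
  then have "log_mart t w \<xi> \<le> ln (2 ^ d * (1 / del) / s ^ d)"
    using s del by (subst ln_ge_iff) auto
  also have "\<dots> = real d * ln 2 + ln (1 / del) - real d * ln s"
    using s del by (simp add: ln_mult ln_div ln_realpow)
  also have "ln s = - (1 / 2 * ln q)"
    using q by (simp add: s_def ln_div ln_sqrt)
  finally show ?thesis
    by (simp add: q_def d_def algebra_simps)
qed

text \<open>Removes \<open>arg_min\<close> from the event: the remaining bounds and the
  measurability proof concern explicit functions of the data.\<close>

lemma gradient_difference:
  "g Q lam (\<lambda>i. X i w) t (theta_hat Q lam (\<lambda>i. X i w) (\<lambda>i. Y i w) t) - g Q lam (\<lambda>i. X i w) t \<theta>s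
    = score t w - lam *\<^sub>R \<theta>s"
  unfolding theta_hat_score[OF lam]
  by (simp add: g_def score_def scaleR_left_diff_distrib sum_subtractf)

text \<open>The regularisation bias \<open>lam *\<^sub>R \<theta>s\<close> adds at most
  \<open>lam * rad * S\<close> to the exponent. After division by \<open>sqrt lam * rad\<close> this
  is the term \<open>sqrt lam * S\<close> of \<open>gamma\<close>.\<close>

lemma confidence_bound:
  assumes w: "w \<in> space P" and del: "0 < del" "del \<le> 1" and S: "norm \<theta>s \<le> S"
    and le: "mixture t w \<le> ennreal (2 ^ CARD('d) * gauss_mass lam rad TYPE(real ^ 'd) / del)"
  shows "wnorm (matrix_inv (H Q lam \<theta>s (\<lambda>i. X i w) t)) (score t w - lam *\<^sub>R \<theta>s)
    \<le> gamma CARD('d) L M S del lam t"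
proof -
  define d where "d = real CARD('d)"
  define l where "l = ln (1 + real t * L / (lam * d))"
  define K where "K = d * (ln 2 + 1 / 2 * l) + ln (1 / del) + lam * (rad * S)"
  have rad: "rad > 0" using M by (simp add: rad_def)
  have d: "d \<ge> 0" by (simp add: d_def)
  have l: "l \<ge> 0" using L lam d by (simp add: l_def)
  have S0: "S \<ge> 0" using S norm_ge_zero order.trans by blast
  have bound: "\<xi> \<bullet> (score t w - lam *\<^sub>R \<theta>s) - \<xi> \<bullet> (H Q lam \<theta>s (\<lambda>i. X i w) t *v \<xi>) \<le> K"
    if \<xi>: "norm \<xi> \<le> rad" for \<xi>
  proof -
    have "- (\<xi> \<bullet> \<theta>s) \<le> norm \<xi> * norm \<theta>s"
      using Cauchy_Schwarz_ineq2[of \<xi> \<theta>s] by linarith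
    also have "\<dots> \<le> rad * S" using \<xi> S rad by (intro mult_mono) auto
    finally have "lam * - (\<xi> \<bullet> \<theta>s) \<le> lam * (rad * S)"
      using lam by (intro mult_left_mono) auto
    then show ?thesis
      using log_mart_bound[OF w del(1) le \<xi>]
      unfolding H_quadratic_form
      by (simp add: log_mart_def info_def inner_diff_right K_def l_def d_def)
  qed
  \<comment> \<open>Here \<open>del \<le> 1\<close> is used, through
    \<open>ln (1 / del) \<ge> 0\<close>.\<close>
  have "K \<ge> 0"
    unfolding K_def using d l del lam rad S0
    by (intro add_nonneg_nonneg mult_nonneg_nonneg) (auto simp: ln_div)
  then have "wnorm (matrix_inv (H Q lam \<theta>s (\<lambda>i. X i w) t)) (score t w - lam *\<^sub>R \<theta>s)
      \<le> (K + lam * rad\<^sup>2) / (sqrt lam * rad)"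
    using lam by (intro wnorm_inverse_H_bound(2) bound rad) auto
  \<comment> \<open>The 1 in \<open>gamma\<close> is an upper bound for \<open>ln 2\<close>.\<close>
  also have "\<dots> \<le> (d * (1 + 1 / 2 * l) + ln (1 / del) + lam * (rad * S) + lam * rad\<^sup>2) / (sqrt lam * rad)"
    unfolding K_def using d lam rad ln_2_less_1
    by (intro divide_right_mono add_right_mono mult_left_mono) auto
  also have "\<dots> = gamma CARD('d) L M S del lam t"
  proof -
    define r where "r = sqrt lam"
    have r: "r > 0" "lam = r * r" using lam by (simp_all add: r_def)
    have "(a + b + r * r * (rad * S) + r * r * rad\<^sup>2) / (r * rad)
        = r * (1 / (2 * M) + S) + 2 * M / r * a + 2 * M / r * b" for a b
      using r(1) M by (simp add: rad_def field_simps power2_eq_square)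
    then show ?thesis
      unfolding gamma_def l_def d_def r_def[symmetric] unfolding r(2)[symmetric] by simp
  qed
  finally show ?thesis .
qed

text \<open>A non-measurable set has \<open>measure\<close> 0, so the lower bound on the probability
  requires a measurable event. As \<open>matrix_inv\<close> is defined by choice, Cramer's rule is
  used to express the norm through determinants, which are polynomials in measurable
  entries.\<close>

lemma wnorm_measurable:
  "(\<lambda>w. wnorm (matrix_inv (H Q lam \<theta>s (\<lambda>i. X i w) t)) (score t w - lam *\<^sub>R \<theta>s)) \<in> borel_measurable P"
proof -
  let ?H = "\<lambda>w. H Q lam \<theta>s (\<lambda>i. X i w) t"
  define v where "v w = score t w - lam *\<^sub>R \<theta>s" for w
  have X: "X i \<in> borel_measurable P" if "i \<ge> 1" for i
    using measurable_from_subalg[OF subalg X_measurable[OF that order.refl]] .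
  have v [measurable]: "v \<in> borel_measurable P"
    unfolding v_def[abs_def] using measurable_from_subalg[OF subalg score_measurable[of t]] by measurable
  have v_comp [measurable]: "(\<lambda>w. v w $ i) \<in> borel_measurable P" for i
    using borel_measurable_inner[OF v borel_measurable_const[of "axis i 1"]] by (simp add: inner_axis)
  have H_comp [measurable]: "(\<lambda>w. ?H w $ i $ j) \<in> borel_measurable P" for i j
  proof -
    have entry: "?H w $ i $ j = axis i 1 \<bullet> (?H w *v axis j 1)" for w
      by (simp add: inner_axis' matrix_vector_mul_component inner_axis)
    have "(\<lambda>w. deriv (mu Q) (X k w \<bullet> \<theta>s) * (X k w \<bullet> axis j 1) * (axis i 1 \<bullet> X k w)) \<in> borel_measurable P"
      if "k \<in> {1..t}" for k
    proof -
      have [measurable]: "X k \<in> borel_measurable P" using that by (intro X) simp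
      show ?thesis by measurable
    qed
    then show ?thesis
      unfolding entry H_vector_mult inner_add_right inner_sum_right inner_scaleR_right
      by (intro borel_measurable_add borel_measurable_sum borel_measurable_const)
  qed
  have inv: "invertible (?H w)" for w
  \<comment> \<open>Only invertibility is wanted here, so trivial data \<open>v = 0\<close>,
    \<open>K = 0\<close> and \<open>R = 1\<close> suffice.\<close>
  proof (rule wnorm_inverse_H_bound(1)[where R = 1 and v = 0 and K = 0])
    fix \<xi>
    have "0 \<le> \<xi> \<bullet> (?H w *v \<xi>)"
      unfolding H_quadratic_form using lam deriv_mu_nonneg
      by (intro add_nonneg_nonneg sum_nonneg mult_nonneg_nonneg) auto
    then show "\<xi> \<bullet> 0 - \<xi> \<bullet> (?H w *v \<xi>) \<le> 0" by simp
  qed (use lam in auto)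
  have "wnorm (matrix_inv (?H w)) (v w)
      = sqrt (\<Sum>k\<in>UNIV. v w $ k * (det (\<chi> i j. if j = k then v w $ i else ?H w $ i $ j) / det (?H w)))" for w
  proof -
    have "?H w *v (matrix_inv (?H w) *v v w) = v w"
      unfolding matrix_vector_mul_assoc
      using someI_ex[OF inv[of w, unfolded invertible_def]] by (simp add: matrix_inv_def)
    moreover have "det (?H w) \<noteq> 0" using inv[of w] by (simp add: invertible_det_nz)
    ultimately have "matrix_inv (?H w) *v v w
        = (\<chi> k. det (\<chi> i j. if j = k then v w $ i else ?H w $ i $ j) / det (?H w))"
      using cramer by blast
    then show ?thesis by (simp add: wnorm_def inner_vec_def)
  qed
  moreover have "(\<lambda>w. det (\<chi> i j. if j = k then v w $ i else ?H w $ i $ j)) \<in> borel_measurable P" for k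
    by (rule borel_measurable_det) simp
  moreover have "(\<lambda>w. det (?H w)) \<in> borel_measurable P"
    by (rule borel_measurable_det) simp
  ultimately show ?thesis
    unfolding v_def[symmetric] by simp
qed

lemma confidence_event_eq:
  "confidence_event P Q L M S \<theta>s X Y del lam
    = {w \<in> space P. \<forall>t. wnorm (matrix_inv (H Q lam \<theta>s (\<lambda>i. X i w) t)) (score t w - lam *\<^sub>R \<theta>s)
        \<le> gamma CARD('d) L M S del lam t}"
  unfolding confidence_event_def Let_def gradient_difference ..

lemma confidence_event_probability:
  assumes del: "0 < del" "del \<le> 1" and S: "norm \<theta>s \<le> S"
  shows "measure P (confidence_event P Q L M S \<theta>s X Y del lam) \<ge> 1 - del"
proof -
  let ?c = "2 ^ CARD('d) * gauss_mass lam rad TYPE(real ^ 'd) / del"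
  let ?A = "{w \<in> space P. \<exists>n. ennreal ?c < mixture n w}"
  let ?E = "confidence_event P Q L M S \<theta>s X Y del lam"
  have [measurable]: "mixture n \<in> borel_measurable P" for n
    using measurable_from_subalg[OF subalg mixture_measurable] .
  have A: "?A \<in> sets P" by measurable
  note wnorm_measurable [measurable]
  have E: "?E \<in> sets P"
    unfolding confidence_event_eq by measurable
  have "space P - ?A \<subseteq> ?E"
    unfolding confidence_event_eq using del S by (auto intro!: confidence_bound simp: not_less)
  then have "measure P (space P - ?A) \<le> measure P ?E"
    using E by (rule P.finite_measure_mono)
  moreover have "measure P (space P - ?A) = 1 - measure P ?A"
    by (rule P.prob_compl[OF A])
  ultimately show ?thesis
    using mixture_deviation[OF del(1)] by linarith
qed

end

theorem lemma4:
  fixes Q :: "real measure"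
    and P :: "'w measure"
    and F :: "nat \<Rightarrow> 'w measure"
    and \<X> :: "(real ^ 'd) set"
    and \<theta>s :: "real ^ 'd"
    and X :: "nat \<Rightarrow> 'w \<Rightarrow> real ^ 'd"
    and Y :: "nat \<Rightarrow> 'w \<Rightarrow> real"
    and L M S del lam :: real
  assumes "real_distribution Q"
    and "non_degenerate Q"
    and "\<And>u. integrable Q (\<lambda>y. exp (u * y))"
    and "L > 0" and "M > 0" and "S > 0"
    and "\<And>u. deriv (mu Q) u \<le> L"
    and "\<And>u. \<bar>deriv (deriv (mu Q)) u\<bar> \<le> M * deriv (mu Q) u"
    and "closed \<X>" and "\<X> \<subseteq> {x. norm x \<le> 1}"
    and "norm \<theta>s \<le> S"
    and "prob_space P"
    and "sequential_interaction P F Q \<X> \<theta>s X Y"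
    and "del > 0" and "lam > 0"
  shows "measure P (confidence_event P Q L M S \<theta>s X Y del lam) \<ge> 1 - del"
proof (cases "del \<le> 1")
  case True
  interpret real_distribution Q by fact
  interpret P: prob_space P by fact
  interpret glm_bandit Q P F \<X> \<theta>s X Y L M lam
    by unfold_locales (use assms in auto)
  show ?thesis
    using True assms by (intro confidence_event_probability) auto
next
  \<comment> \<open>For \<open>del > 1\<close> the term \<open>ln (1 / del)\<close> is negative and
    \<open>confidence_bound\<close> does not apply, but the claimed lower bound is then below
    0.\<close>
  case False
  then have "1 - del \<le> 0" by simp
  also have "0 \<le> measure P (confidence_event P Q L M S \<theta>s X Y del lam)" by simp
  finally show ?thesis .
qed

end
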